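(* (1) There exists a Dedekind domain $A$ having an overring that is well-centered on $A$ but is not a localization of $A$. (2) There exists a Dedekind domain $A$ having an overring that is almost well-centered on $A$ but is not well-centered on $A$. Moreover, in each of the cases (1) and (2) the Dedekind domain $A$ can be chosen so that $A$ has exactly two overrings that are almost well-centered on $A$ and are not localizations of $A$, and these two overrings are also exactly the overrings $D\neq A$ of $A$ that are almost well-centered on $A$ and satisfy $\mathcal U(D)\cap A=\mathcal U(A)$.
   Context: For an integral domain $A$ with field of fractions $K$, an overring of $A$ is a subring $D$ of $K$ with $A\subseteq D$. $\mathcal U(R)$ is the unit group of a ring $R$. $D$ is well-centered on $A$ if for each $d\in D$ there is $u\in\mathcal U(D)$ with $ud\in A$; $D$ is almost well-centered on $A$ if for each $d\in D$ there are a positive integer $n$ and $u\in\mathcal U(D)$ with $ud^n\in A$. $D$ is a localization of $A$ if $D=S^{-1}A$ for some multiplicatively closed set $S$ of nonzero elements of $A$. *)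

theory Defs
  imports "HOL-Algebra.Algebra"
begin

text \<open>Throughout, an integral domain A is represented as a subring A of a field K
  (a HOL-Algebra structure) such that K is the field of fractions of A.
  Overrings of A are then subrings D of K containing A.\<close>

definition frac_field_of :: "('a, 'b) ring_scheme \<Rightarrow> 'a set \<Rightarrow> bool" where
  "frac_field_of K A \<longleftrightarrow> field K \<and> subring A K \<and>
     (\<forall>x\<in>carrier K. \<exists>a\<in>A. \<exists>b\<in>A. b \<noteq> \<zero>\<^bsub>K\<^esub> \<and> x = a \<otimes>\<^bsub>K\<^esub> inv\<^bsub>K\<^esub> b)"

definition integrally_closed_in :: "('a, 'b) ring_scheme \<Rightarrow> 'a set \<Rightarrow> bool" where
  "integrally_closed_in K A \<longleftrightarrow>
     (\<forall>x\<in>carrier K. \<forall>p. polynomial\<^bsub>K\<^esub> A p \<and> p \<noteq> [] \<and> lead_coeff p = \<one>\<^bsub>K\<^esub>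
        \<and> ring.eval K p x = \<zero>\<^bsub>K\<^esub> \<longrightarrow> x \<in> A)"

definition dedekind_domain_in :: "('a, 'b) ring_scheme \<Rightarrow> 'a set \<Rightarrow> bool" where
  "dedekind_domain_in K A \<longleftrightarrow> frac_field_of K A \<and>
     noetherian_domain (K\<lparr>carrier := A\<rparr>) \<and> integrally_closed_in K A \<and>
     (\<forall>P. primeideal P (K\<lparr>carrier := A\<rparr>) \<and> P \<noteq> {\<zero>\<^bsub>K\<^esub>}
        \<longrightarrow> maximalideal P (K\<lparr>carrier := A\<rparr>))"

definition overring :: "('a, 'b) ring_scheme \<Rightarrow> 'a set \<Rightarrow> 'a set \<Rightarrow> bool" where
  "overring K A D \<longleftrightarrow> subring D K \<and> A \<subseteq> D"

abbreviation units_in :: "('a, 'b) ring_scheme \<Rightarrow> 'a set \<Rightarrow> 'a set" where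
  "units_in K D \<equiv> Units (K\<lparr>carrier := D\<rparr>)"

definition well_centered :: "('a, 'b) ring_scheme \<Rightarrow> 'a set \<Rightarrow> 'a set \<Rightarrow> bool" where
  "well_centered K A D \<longleftrightarrow> (\<forall>d\<in>D. \<exists>u\<in>units_in K D. u \<otimes>\<^bsub>K\<^esub> d \<in> A)"

definition almost_well_centered :: "('a, 'b) ring_scheme \<Rightarrow> 'a set \<Rightarrow> 'a set \<Rightarrow> bool" where
  "almost_well_centered K A D \<longleftrightarrow>
     (\<forall>d\<in>D. \<exists>n::nat. n > 0 \<and> (\<exists>u\<in>units_in K D. u \<otimes>\<^bsub>K\<^esub> (d [^]\<^bsub>K\<^esub> n) \<in> A))"

definition is_localization :: "('a, 'b) ring_scheme \<Rightarrow> 'a set \<Rightarrow> 'a set \<Rightarrow> bool" where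
  "is_localization K A D \<longleftrightarrow>
     (\<exists>S. S \<subseteq> A - {\<zero>\<^bsub>K\<^esub>} \<and> \<one>\<^bsub>K\<^esub> \<in> S \<and>
          (\<forall>s\<in>S. \<forall>t\<in>S. s \<otimes>\<^bsub>K\<^esub> t \<in> S) \<and>
          D = {a \<otimes>\<^bsub>K\<^esub> inv\<^bsub>K\<^esub> s | a s. a \<in> A \<and> s \<in> S})"

definition exactly_two_special :: "('a, 'b) ring_scheme \<Rightarrow> 'a set \<Rightarrow> bool" where
  "exactly_two_special K A \<longleftrightarrow>
     (\<exists>D1 D2. D1 \<noteq> D2 \<and>
        {D. overring K A D \<and> almost_well_centered K A D \<and> \<not> is_localization K A D} = {D1, D2} \<and>
        {D. overring K A D \<and> D \<noteq> A \<and> almost_well_centered K A D \<and>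
            units_in K D \<inter> A = units_in K A} = {D1, D2})"

end

theory Submission
  imports Defs "HOL-Library.Z2" "HOL-Algebra.Algebraic_Closure_Type"
    "HOL-Computational_Algebra.Computational_Algebra" "HOL-Analysis.Abstract_Topology_2"
begin

text \<open>
  Let \<open>R = F\<^sub>2[[t]][x]\<close> with field of fractions \<open>K\<close>. Two transcendental arcs, \<open>(t, x) = (s^2, s^3 \<gamma>(s))\<close> and
  \<open>(t, x) = (s, 1 + s \<gamma>(s))\<close>, where the coefficients of \<open>\<gamma>\<close> are infinitely many elements of the algebraic
  closure of \<open>F\<^sub>2\<close>, define discrete valuations \<open>v\<^sub>1\<close>, \<open>v\<^sub>2\<close> of \<open>K\<close> with algebraic residue fields. Give them the
  weights \<open>1\<close> and \<open>-2\<close>, and give a prime \<open>f\<close> of \<open>R\<close> not associated to \<open>t\<close> the weight \<open>2 v\<^sub>2(f) - v\<^sub>1(f)\<close>.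
  As \<open>(v\<^sub>1(t), v\<^sub>2(t)) = (2, 1)\<close>, divisors of weight 0 are exactly the principal ones, up to primes of
  weight 0. Let \<open>A\<close> be the intersection of the valuation rings of nonzero weight: a Dedekind
  domain with class group \<open>\<int>\<close>, the class of a prime being its weight.

  An overring is given by the set \<open>\<Lambda>\<close> of primes of \<open>A\<close> that it inverts. If \<open>\<Lambda>\<close> meets both signs, some
  positive combination is principal and the overring is a localization. If \<open>\<Lambda>\<close> is a proper nonempty
  part of one sign class, then for \<open>p \<notin> \<Lambda>\<close>, \<open>q \<in> \<Lambda>\<close> of that sign an element with divisor
  \<open>w(q) p - w(p) q\<close> contradicts almost well-centeredness. If \<open>\<Lambda>\<close> is a whole sign class, no nonzero
  effective divisor supported in \<open>\<Lambda>\<close> is principal, so the overring is not a localization, but it is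
  almost well-centered: multiples of a single prime represent enough classes.

  Inverting the positive primes gives a well-centered overring because the weight 1 occurs.
  Inverting the negative ones does not, because the weights \<open>-2\<close> and \<open>-3\<close> occur but \<open>-1\<close> does not:
  \<open>v\<^sub>1(f) = 2 v\<^sub>2(f) + 1\<close> and \<open>v\<^sub>1(f) \<noteq> 1\<close> (the values of \<open>v\<^sub>1\<close> on \<open>R\<close> are 0, 2, 3, ...) force both
  valuations to be positive, so \<open>f\<close> modulo \<open>t\<close> vanishes at 0 and at 1 and \<open>f\<close> is reducible by
  Hensel's lemma.
\<close>

hide_const (open) Divisibility.prime Divisibility.irreducible

section \<open>Dedekind domains defined by families of valuations\<close>

definition ideal_set :: "'k::field set \<Rightarrow> 'k set \<Rightarrow> bool" where
  "ideal_set A J \<longleftrightarrow> J \<subseteq> A \<and> 0 \<in> J \<and> (\<forall>x\<in>J. \<forall>y\<in>J. x + y \<in> J) \<and> (\<forall>a\<in>A. \<forall>x\<in>J. a * x \<in> J)"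

definition subring_set :: "'k::field set \<Rightarrow> bool" where
  "subring_set D \<longleftrightarrow> 1 \<in> D \<and> (\<forall>x\<in>D. - x \<in> D) \<and> (\<forall>x\<in>D. \<forall>y\<in>D. x + y \<in> D \<and> x * y \<in> D)"

definition unit_set :: "'k::field set \<Rightarrow> 'k set" where
  "unit_set D = {x \<in> D. \<exists>y\<in>D. x * y = 1}"

definition almost_well_centered_set :: "'k::field set \<Rightarrow> 'k set \<Rightarrow> bool" where
  "almost_well_centered_set A D \<longleftrightarrow> (\<forall>d\<in>D. \<exists>n>0. \<exists>u\<in>unit_set D. u * d ^ n \<in> A)"

definition well_centered_set :: "'k::field set \<Rightarrow> 'k set \<Rightarrow> bool" where
  "well_centered_set A D \<longleftrightarrow> (\<forall>d\<in>D. \<exists>u\<in>unit_set D. u * d \<in> A)"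

definition localization_set :: "'k::field set \<Rightarrow> 'k set \<Rightarrow> bool" where
  "localization_set A D \<longleftrightarrow> (\<exists>S. S \<subseteq> A - {0} \<and> 1 \<in> S \<and> (\<forall>s\<in>S. \<forall>t\<in>S. s * t \<in> S) \<and>
     D = {a / s | a s. a \<in> A \<and> s \<in> S})"

lemma ideal_set_sum: "ideal_set A J \<Longrightarrow> finite S \<Longrightarrow> (\<And>i. i \<in> S \<Longrightarrow> f i \<in> J) \<Longrightarrow> sum f S \<in> J"
  by (rotate_tac, induction S rule: finite_induct) (auto simp: ideal_set_def)

section \<open>Families of discrete valuations with finite support\<close>

locale valuation_family =
  fixes I :: "'i set" and v :: "'i \<Rightarrow> 'k::field \<Rightarrow> int"
  assumes v_mult: "i \<in> I \<Longrightarrow> x \<noteq> 0 \<Longrightarrow> y \<noteq> 0 \<Longrightarrow> v i (x * y) = v i x + v i y"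
    and v_add: "i \<in> I \<Longrightarrow> x \<noteq> 0 \<Longrightarrow> y \<noteq> 0 \<Longrightarrow> x + y \<noteq> 0 \<Longrightarrow> min (v i x) (v i y) \<le> v i (x + y)"
    and finite_support: "x \<noteq> 0 \<Longrightarrow> finite {i \<in> I. v i x \<noteq> 0}"
begin

text \<open>The value \<open>v i 0\<close> is arbitrary; \<open>ge\<close> treats it as infinite.\<close>

definition ge :: "'i \<Rightarrow> int \<Rightarrow> 'k \<Rightarrow> bool" where
  "ge i n x \<longleftrightarrow> x = 0 \<or> n \<le> v i x"

definition ring_at :: "'i set \<Rightarrow> 'k set" where
  "ring_at J = {x. \<forall>i\<in>J. ge i 0 x}"

abbreviation "A \<equiv> ring_at I"

lemma v_one [simp]: "i \<in> I \<Longrightarrow> v i 1 = 0"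
  using v_mult[of i 1 1] by simp

lemma v_minus_one: "i \<in> I \<Longrightarrow> v i (-1) = 0"
  using v_mult[of i "-1" "-1"] by simp

lemma v_minus [simp]: "i \<in> I \<Longrightarrow> v i (- x) = v i x"
  using v_mult[of i "-1" x] v_minus_one by (cases "x = 0") auto

lemma v_inverse: "i \<in> I \<Longrightarrow> x \<noteq> 0 \<Longrightarrow> v i (inverse x) = - v i x"
  using v_mult[of i x "inverse x"] by simp

lemma v_divide: "i \<in> I \<Longrightarrow> x \<noteq> 0 \<Longrightarrow> y \<noteq> 0 \<Longrightarrow> v i (x / y) = v i x - v i y"
  using v_mult[of i x "inverse y"] v_inverse[of i y] by (simp add: divide_inverse)

lemma v_power: "i \<in> I \<Longrightarrow> x \<noteq> 0 \<Longrightarrow> v i (x ^ n) = int n * v i x"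
  by (induction n) (auto simp: v_mult algebra_simps)

lemma ge_zero [simp]: "ge i n 0"
  by (simp add: ge_def)

lemma ge_one [simp]: "i \<in> I \<Longrightarrow> ge i 0 1"
  by (simp add: ge_def)

lemma ge_mono: "ge i n x \<Longrightarrow> m \<le> n \<Longrightarrow> ge i m x"
  by (auto simp: ge_def)

lemma ge_add: "i \<in> I \<Longrightarrow> ge i n x \<Longrightarrow> ge i n y \<Longrightarrow> ge i n (x + y)"
  using v_add[of i x y]
  by (cases "x = 0 \<or> y = 0 \<or> x + y = 0") (auto simp: ge_def min_def split: if_splits)

lemma ge_minus [simp]: "i \<in> I \<Longrightarrow> ge i n (- x) \<longleftrightarrow> ge i n x"
  by (auto simp: ge_def)

lemma ge_diff: "i \<in> I \<Longrightarrow> ge i n x \<Longrightarrow> ge i n y \<Longrightarrow> ge i n (x - y)"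
  using ge_add[of i n x "- y"] by simp

lemma ge_mult: "i \<in> I \<Longrightarrow> ge i m x \<Longrightarrow> ge i n y \<Longrightarrow> ge i (m + n) (x * y)"
  by (cases "x = 0 \<or> y = 0") (auto simp: ge_def v_mult)

lemma ge_mult_left: "i \<in> I \<Longrightarrow> ge i 0 x \<Longrightarrow> ge i n y \<Longrightarrow> ge i n (x * y)"
  using ge_mult[of i 0 x n y] by simp

lemma ge_sum: "i \<in> I \<Longrightarrow> (\<And>j. j \<in> S \<Longrightarrow> ge i n (f j)) \<Longrightarrow> ge i n (sum f S)"
  by (induction S rule: infinite_finite_induct) (auto intro: ge_add)

lemma ge_divide: "i \<in> I \<Longrightarrow> ge i n x \<Longrightarrow> y \<noteq> 0 \<Longrightarrow> ge i (n - v i y) (x / y)"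
  by (cases "x = 0") (auto simp: ge_def v_divide)

lemma ge_power: "i \<in> I \<Longrightarrow> ge i n x \<Longrightarrow> ge i (int m * n) (x ^ m)"
proof (induction m)
  case (Suc m)
  then show ?case using ge_mult[of i n x "int m * n" "x ^ m"] by (simp add: algebra_simps)
qed simp

lemma ge_power_minus_one:
  assumes "i \<in> I" "ge i 0 x" "ge i 1 (x - 1)"
  shows "ge i 1 (x ^ m - 1)"
proof (induction m)
  case (Suc m)
  have "ge i 1 (x * (x ^ m - 1) + (x - 1))"
    using assms Suc by (intro ge_add ge_mult_left) auto
  then show ?case by (simp add: algebra_simps)
qed simp

lemma v_power_int: "i \<in> I \<Longrightarrow> x \<noteq> 0 \<Longrightarrow> v i (x powi k) = k * v i x"
  by (auto simp: power_int_def v_power v_inverse)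

lemma v_prod:
  "i \<in> I \<Longrightarrow> (\<And>j. j \<in> S \<Longrightarrow> f j \<noteq> 0) \<Longrightarrow> v i (prod f S) = (\<Sum>j\<in>S. v i (f j))"
  by (induction S rule: infinite_finite_induct) (auto simp: v_mult)

lemma ring_at_subring: "J \<subseteq> I \<Longrightarrow> subring_set (ring_at J)"
  using ge_mult[of _ 0 _ 0] by (auto simp: subring_set_def ring_at_def intro: ge_add)

lemma ring_at_closed:
  assumes "J \<subseteq> I" "x \<in> ring_at J" "y \<in> ring_at J"
  shows "x + y \<in> ring_at J" "x * y \<in> ring_at J" "- x \<in> ring_at J" "x - y \<in> ring_at J"
  using ring_at_subring[OF assms(1)] assms(2,3)
  by (auto simp: subring_set_def) (metis uminus_add_conv_diff add.commute)

lemma zero_one_in_ring_at [simp]: "0 \<in> ring_at J" "J \<subseteq> I \<Longrightarrow> 1 \<in> ring_at J"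
  by (auto simp: ring_at_def)

lemma ring_at_power: "J \<subseteq> I \<Longrightarrow> x \<in> ring_at J \<Longrightarrow> x ^ n \<in> ring_at J"
  by (induction n) (auto intro: ring_at_closed)

lemma ring_at_sum: "J \<subseteq> I \<Longrightarrow> (\<And>j. j \<in> S \<Longrightarrow> f j \<in> ring_at J) \<Longrightarrow> sum f S \<in> ring_at J"
  by (induction S rule: infinite_finite_induct) (auto intro: ring_at_closed)

lemma ring_at_antimono: "J \<subseteq> J' \<Longrightarrow> ring_at J' \<subseteq> ring_at J"
  by (auto simp: ring_at_def)

lemma unit_set_ring_at:
  assumes "J \<subseteq> I"
  shows "unit_set (ring_at J) = {x. x \<noteq> 0 \<and> (\<forall>i\<in>J. v i x = 0)}"
proof safe
  fix x i assume x: "x \<in> unit_set (ring_at J)" and i: "i \<in> J"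
  then obtain y where y: "y \<in> ring_at J" "x * y = 1"
    by (auto simp: unit_set_def)
  then have nz: "x \<noteq> 0" "y \<noteq> 0" by auto
  have "v i x + v i y = 0"
    using v_mult[of i x y] nz y i assms by (auto simp: subset_iff)
  moreover have "0 \<le> v i x" "0 \<le> v i y"
    using x y i nz by (auto simp: unit_set_def ring_at_def ge_def)
  ultimately show "v i x = 0" by linarith
next
  fix x assume "x \<noteq> 0" "\<forall>i\<in>J. v i x = 0"
  then show "x \<in> unit_set (ring_at J)"
    unfolding unit_set_def ring_at_def ge_def using assms
    by (auto intro!: exI[of _ "inverse x"] simp: v_inverse subset_iff)
qed (auto simp: unit_set_def)

end

text \<open>The assumptions say that the center of each valuation on \<open>A\<close> is a maximal
  ideal and that the centers of different places are incomparable.\<close>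

locale dedekind_family = valuation_family +
  assumes residue_inverse: "i \<in> I \<Longrightarrow> b \<in> A \<Longrightarrow> b \<noteq> 0 \<Longrightarrow> v i b = 0 \<Longrightarrow> \<exists>b'\<in>A. ge i 1 (b * b' - 1)"
    and separation: "i \<in> I \<Longrightarrow> j \<in> I \<Longrightarrow> i \<noteq> j \<Longrightarrow> \<exists>a\<in>A. a \<noteq> 0 \<and> v i a = 0 \<and> 0 < v j a"
begin

section \<open>Approximation by elements of \<open>A\<close>\<close>

lemma A_ge: "x \<in> A \<Longrightarrow> i \<in> I \<Longrightarrow> ge i 0 x"
  by (auto simp: ring_at_def)

lemma A_v_nonneg: "x \<in> A \<Longrightarrow> i \<in> I \<Longrightarrow> x \<noteq> 0 \<Longrightarrow> 0 \<le> v i x"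
  by (auto simp: ring_at_def ge_def)

text \<open>A product of \<open>m\<close>-th powers of elements that separate \<open>i\<close> from
  the single places of \<open>J\<close>.\<close>

lemma multiple_avoiding:
  assumes "i \<in> I" "finite J" "J \<subseteq> I - {i}"
  shows "\<exists>a\<in>A. a \<noteq> 0 \<and> v i a = 0 \<and> (\<forall>j\<in>J. int m \<le> v j a)"
  using assms(2,3)
proof (induction J rule: finite_induct)
  case empty
  then show ?case using assms(1) by (intro bexI[of _ 1]) auto
next
  case (insert j J)
  then obtain a where a: "a \<in> A" "a \<noteq> 0" "v i a = 0" "\<forall>j\<in>J. int m \<le> v j a"
    by auto
  from insert obtain b where b: "b \<in> A" "b \<noteq> 0" "v i b = 0" "0 < v j b"
    using separation[of i j] assms(1) by auto
  have bm: "b ^ m \<in> A" by (rule ring_at_power) (use b in auto)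
  have "int m \<le> v l (a * b ^ m)" if "l \<in> insert j J" for l
  proof -
    have l: "l \<in> I" using that insert by auto
    have eq: "v l (a * b ^ m) = v l a + int m * v l b"
      using a b l by (simp add: v_mult v_power)
    have nn: "0 \<le> v l a" "0 \<le> v l b" using A_v_nonneg a b l by auto
    show ?thesis
    proof (cases "l = j")
      case True
      have "int m * 1 \<le> int m * v j b" using b(4) by (intro mult_left_mono) auto
      then show ?thesis using eq nn True by simp
    next
      case False
      then have "int m \<le> v l a" using that a by auto
      moreover have "0 \<le> int m * v l b" using nn by simp
      ultimately show ?thesis using eq by linarith
    qed
  qed
  moreover have "v i (a * b ^ m) = 0"
    using a b assms(1) by (simp add: v_mult v_power)
  moreover have "a * b ^ m \<in> A" "a * b ^ m \<noteq> 0"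
    using a b bm by (auto intro: ring_at_closed)
  ultimately show ?case by blast
qed

text \<open>The finitely many poles of \<open>x\<close> avoid \<open>i\<close>, so
  \<open>multiple_avoiding\<close> supplies a denominator. Thus the localization of \<open>A\<close>
  at the center of \<open>v i\<close> is the full valuation ring.\<close>

lemma denominator_avoiding:
  assumes i: "i \<in> I" and x: "ge i 0 x"
  shows "\<exists>a\<in>A. a \<noteq> 0 \<and> v i a = 0 \<and> a * x \<in> A"
proof (cases "x = 0")
  case True
  then show ?thesis using i by (intro bexI[of _ 1]) auto
next
  case False
  define J where "J = {j \<in> I. v j x < 0}"
  have fin: "finite J"
    by (rule finite_subset[OF _ finite_support[OF False]]) (auto simp: J_def)
  have sub: "J \<subseteq> I - {i}" using x False by (auto simp: J_def ge_def)
  \<comment> \<open>As a sum of nonnegative terms, \<open>m\<close> bounds the order of every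
    pole.\<close>
  define m where "m = (\<Sum>j\<in>J. nat (- v j x))"
  obtain a where a: "a \<in> A" "a \<noteq> 0" "v i a = 0" "\<forall>j\<in>J. int m \<le> v j a"
    using multiple_avoiding[OF i fin sub, of m] by auto
  have "ge j 0 (a * x)" if j: "j \<in> I" for j
  proof (cases "j \<in> J")
    case True
    then have "nat (- v j x) \<le> m"
      unfolding m_def by (rule member_le_sum) (use fin in auto)
    moreover have "int m \<le> v j a" using a True by auto
    ultimately show ?thesis using a False j by (simp add: ge_def v_mult)
  next
    case nJ: False
    then have "0 \<le> v j x" using j by (auto simp: J_def)
    then show ?thesis using a False j A_v_nonneg[of a j] by (simp add: ge_def v_mult)
  qed
  then show ?thesis using a by (auto simp: ring_at_def)
qed

text \<open>At any one place either \<open>x\<close> or its inverse is integral, and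
  \<open>denominator_avoiding\<close> applies to that one. For empty \<open>I\<close> the ring
  \<open>A\<close> is the whole field.\<close>

lemma fraction: "\<exists>a\<in>A. \<exists>b\<in>A. b \<noteq> 0 \<and> x = a / b"
proof (cases "x = 0 \<or> I = {}")
  case True
  then show ?thesis by (intro bexI[of _ x] bexI[of _ 1]) (auto simp: ring_at_def)
next
  case False
  then obtain i where i: "i \<in> I" and x: "x \<noteq> 0" by auto
  show ?thesis
  proof (cases "0 \<le> v i x")
    case True
    then obtain a where "a \<in> A" "a \<noteq> 0" "a * x \<in> A"
      using denominator_avoiding[OF i, of x] by (auto simp: ge_def)
    then show ?thesis by (intro bexI[of _ "a * x"] bexI[of _ a]) auto
  next
    case False
    then have "ge i 0 (inverse x)" using i x by (simp add: ge_def v_inverse)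
    then obtain a where "a \<in> A" "a \<noteq> 0" "a * inverse x \<in> A"
      using denominator_avoiding[OF i, of "inverse x"] by auto
    then show ?thesis using x
      by (intro bexI[of _ a] bexI[of _ "a * inverse x"] conjI) (auto simp: field_simps)
  qed
qed

text \<open>Errors multiply: correcting an inverse modulo order \<open>n\<close> by an inverse
  \<open>c\<close> modulo order 1 leaves, up to sign, the product of the two errors.\<close>

lemma inverse_approx:
  assumes i: "i \<in> I" and b: "b \<in> A" "b \<noteq> 0" "v i b = 0"
  shows "\<exists>b'\<in>A. ge i (int n) (b * b' - 1)"
proof (induction n)
  case 0
  have "ge i 0 (b * 0 - 1)" using i ge_minus[of i 0 1] by simp
  then show ?case by (intro bexI[of _ 0]) auto
next
  case (Suc n)
  then obtain b' where b': "b' \<in> A" "ge i (int n) (b * b' - 1)" by auto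
  obtain c where c: "c \<in> A" "ge i 1 (b * c - 1)"
    using residue_inverse[OF i b] by auto
  have "ge i (int n + 1) ((b * b' - 1) * - (b * c - 1))"
    using b' c i by (intro ge_mult) (simp_all only: ge_minus)
  moreover have "(b * b' - 1) * - (b * c - 1) = b * (b' + c * (1 - b * b')) - 1"
    by (simp add: algebra_simps)
  moreover have "b' + c * (1 - b * b') \<in> A"
    using b b' c by (intro ring_at_closed) auto
  ultimately show ?case by (intro bexI[of _ "b' + c * (1 - b * b')"]) (auto simp: add.commute)
qed

text \<open>After clearing the poles of \<open>c\<close> by a denominator \<open>a\<close> that is a
  unit at \<open>i\<close>, an approximate inverse of \<open>a\<close> replaces the exact
  one.\<close>

lemma approx_single:
  assumes i: "i \<in> I" and c: "ge i 0 c"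
  shows "\<exists>z\<in>A. ge i (int n) (z - c)"
proof -
  obtain a where a: "a \<in> A" "a \<noteq> 0" "v i a = 0" "a * c \<in> A"
    using denominator_avoiding[OF i c] by auto
  obtain b where b: "b \<in> A" "ge i (int n) (a * b - 1)"
    using inverse_approx[OF i a(1-3)] by auto
  have "ge i (int n) (c * (a * b - 1))"
    using b c i by (intro ge_mult_left) auto
  then have "ge i (int n) (a * c * b - c)"
    by (simp add: algebra_simps)
  moreover have "a * c * b \<in> A" using ring_at_closed(2)[of I "a * c" b] a b by simp
  ultimately show ?thesis by blast
qed

text \<open>An element vanishing to order \<open>n\<close> on \<open>J\<close> and a unit at
  \<open>i\<close>, multiplied by an approximate inverse at \<open>i\<close>.\<close>

lemma approx_idempotent:
  assumes "i \<in> I" "finite J" "J \<subseteq> I - {i}"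
  shows "\<exists>e\<in>A. ge i (int n) (e - 1) \<and> (\<forall>j\<in>J. ge j (int n) e)"
proof -
  obtain a where a: "a \<in> A" "a \<noteq> 0" "v i a = 0" "\<forall>j\<in>J. int n \<le> v j a"
    using multiple_avoiding[OF assms, of n] by auto
  obtain b where b: "b \<in> A" "ge i (int n) (a * b - 1)"
    using inverse_approx[OF assms(1) a(1-3)] by auto
  have "ge j (int n) (a * b)" if "j \<in> J" for j
    using ge_mult_left[of j b "int n" a] that assms a b A_ge[of b j]
    by (auto simp: ge_def mult.commute)
  then show ?thesis using a b by (intro bexI[of _ "a * b"]) (auto intro: ring_at_closed)
qed

text \<open>Chinese remainder argument: the local approximations \<open>z j\<close> are combined
  with elements \<open>e j\<close> close to 1 at \<open>j\<close> and close to 0 at the rest of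
  \<open>J\<close>.\<close>

lemma strong_approximation:
  assumes J: "finite J" "J \<subseteq> I" and c: "\<And>j. j \<in> J \<Longrightarrow> ge j 0 (c j)"
  shows "\<exists>z\<in>A. \<forall>j\<in>J. ge j (int n) (z - c j)"
proof -
  have "\<forall>j\<in>J. \<exists>z\<in>A. ge j (int n) (z - c j)"
    using approx_single J c by blast
  then obtain z where z: "\<And>j. j \<in> J \<Longrightarrow> z j \<in> A" "\<And>j. j \<in> J \<Longrightarrow> ge j (int n) (z j - c j)"
    by metis
  have "\<forall>j\<in>J. \<exists>e\<in>A. ge j (int n) (e - 1) \<and> (\<forall>k\<in>J - {j}. ge k (int n) e)"
  proof
    fix j assume "j \<in> J"
    then show "\<exists>e\<in>A. ge j (int n) (e - 1) \<and> (\<forall>k\<in>J - {j}. ge k (int n) e)"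
      using J by (intro approx_idempotent) auto
  qed
  then obtain e where e: "\<And>j. j \<in> J \<Longrightarrow> e j \<in> A" "\<And>j. j \<in> J \<Longrightarrow> ge j (int n) (e j - 1)"
    "\<And>j k. j \<in> J \<Longrightarrow> k \<in> J - {j} \<Longrightarrow> ge k (int n) (e j)"
    by metis
  have "ge i (int n) ((\<Sum>j\<in>J. e j * z j) - c i)" if i: "i \<in> J" for i
  proof -
    have iI: "i \<in> I" using i J by auto
    have "ge i (int n) (\<Sum>j\<in>J - {i}. e j * z j)"
    proof (rule ge_sum[OF iI])
      fix j assume j: "j \<in> J - {i}"
      show "ge i (int n) (e j * z j)"
        using ge_mult_left[of i "z j" "int n" "e j"] e(3)[of j i] i j iI A_ge[OF z(1)]
        by (auto simp: mult.commute)
    qed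
    moreover have "ge i (int n) (z i * (e i - 1))"
      using ge_mult_left[OF iI A_ge[OF z(1)[OF i] iI] e(2)[OF i]] .
    moreover have "(\<Sum>j\<in>J. e j * z j) - c i = (\<Sum>j\<in>J - {i}. e j * z j) + (z i * (e i - 1) + (z i - c i))"
      using sum.remove[OF J(1) i, of "\<lambda>j. e j * z j"] by (simp add: algebra_simps)
    ultimately show ?thesis
      using z(2)[OF i] iI by (metis ge_add)
  qed
  moreover have "(\<Sum>j\<in>J. e j * z j) \<in> A"
    using e z by (intro ring_at_sum ring_at_closed) auto
  ultimately show ?thesis by blast
qed

section \<open>Ideals, integral closure and overrings\<close>

lemma ideal_membership:
  assumes J: "ideal_set A J" and x: "x \<in> J" "x \<noteq> 0" and a: "a \<in> A" "a \<noteq> 0"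
    and le: "\<And>i. i \<in> I \<Longrightarrow> v i x \<noteq> 0 \<Longrightarrow> \<exists>y\<in>J. y \<noteq> 0 \<and> v i y \<le> v i a"
  shows "a \<in> J"
proof -
  define S where "S = {i \<in> I. v i x \<noteq> 0}"
  have S: "finite S" "S \<subseteq> I" using finite_support[OF x(2)] by (auto simp: S_def)
  have JA: "J \<subseteq> A" using J by (auto simp: ideal_set_def)
  have xA: "x \<in> A" using x JA by auto
  define n where "n = nat (\<Sum>i\<in>S. v i x)"
  have vx: "v i x \<le> int n" if "i \<in> S" for i
  proof -
    have "v i x \<le> (\<Sum>i\<in>S. v i x)"
      by (rule member_le_sum) (use that S xA x A_v_nonneg in auto)
    then show ?thesis unfolding n_def by simp
  qed
  have "\<forall>i\<in>S. \<exists>y\<in>J. y \<noteq> 0 \<and> v i y \<le> v i a" using le by (auto simp: S_def)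
  then obtain y where y: "\<And>i. i \<in> S \<Longrightarrow> y i \<in> J" "\<And>i. i \<in> S \<Longrightarrow> y i \<noteq> 0"
    "\<And>i. i \<in> S \<Longrightarrow> v i (y i) \<le> v i a" by metis
  \<comment> \<open>The value conditions at the zeros of \<open>x\<close> suffice: with
    \<open>z i\<close> close to \<open>a / y i\<close> at \<open>i\<close> and close to 0 at the
    other points of \<open>S\<close>, the sum of the \<open>z i * y i\<close> lies in
    \<open>J\<close> and differs from \<open>a\<close> by a multiple of \<open>x\<close>.\<close>
  have "\<forall>i\<in>S. \<exists>z\<in>A. \<forall>j\<in>S. ge j (int n) (z - (if j = i then a / y i else 0))"
  proof
    fix i assume i: "i \<in> S"
    then have "ge i 0 (a / y i)"
      using y[OF i] a i S by (auto simp: ge_def v_divide subset_iff)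
    then show "\<exists>z\<in>A. \<forall>j\<in>S. ge j (int n) (z - (if j = i then a / y i else 0))"
      by (intro strong_approximation S) auto
  qed
  then obtain z where z: "\<And>i. i \<in> S \<Longrightarrow> z i \<in> A"
    "\<And>i j. i \<in> S \<Longrightarrow> j \<in> S \<Longrightarrow> ge j (int n) (z i - (if j = i then a / y i else 0))"
    by metis
  define r where "r = a - (\<Sum>i\<in>S. z i * y i)"
  have rn: "ge i (int n) r" if i: "i \<in> S" for i
  proof -
    have iI: "i \<in> I" using i S by auto
    have y_ge: "ge i 0 (y j)" if "j \<in> S" for j
      using y(1)[OF that] JA iI A_ge by auto
    have "ge i (int n) (\<Sum>j\<in>S - {i}. z j * y j)"
    proof (rule ge_sum[OF iI])
      fix j assume j: "j \<in> S - {i}"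
      then have "ge i (int n) (z j)" using z(2)[of j i] i by auto
      then show "ge i (int n) (z j * y j)"
        using ge_mult_left[OF iI y_ge, of j "int n" "z j"] j by (auto simp: mult.commute)
    qed
    moreover have "ge i (int n) (y i * (z i - a / y i))"
      using ge_mult_left[OF iI y_ge[OF i]] z(2)[OF i i] by auto
    moreover have "r = - (y i * (z i - a / y i)) - (\<Sum>j\<in>S - {i}. z j * y j)"
      unfolding r_def using sum.remove[OF S(1) i, of "\<lambda>j. z j * y j"] y(2)[OF i]
      by (simp add: algebra_simps)
    ultimately show ?thesis using iI by (simp add: ge_diff)
  qed
  have sumJ: "(\<Sum>i\<in>S. z i * y i) \<in> J"
    by (rule ideal_set_sum[OF J S(1)]) (use J z y in \<open>auto simp: ideal_set_def\<close>)
  have rA: "r \<in> A"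
    unfolding r_def using a sumJ JA by (intro ring_at_closed) auto
  have "r / x \<in> A"
  proof -
    have "ge i 0 (r / x)" if i: "i \<in> I" for i
    proof (cases "r = 0")
      case False
      show ?thesis
      proof (cases "i \<in> S")
        case True
        then show ?thesis using rn[OF True] vx[OF True] False x i by (simp add: ge_def v_divide)
      next
        case nS: False
        then show ?thesis using A_v_nonneg[OF rA i False] False x i by (auto simp: ge_def v_divide S_def)
      qed
    qed auto
    then show ?thesis by (auto simp: ring_at_def)
  qed
  then have "r / x * x \<in> J" using J x unfolding ideal_set_def by blast
  then have "r \<in> J" using x by simp
  then have "r + (\<Sum>i\<in>S. z i * y i) \<in> J" using sumJ J by (auto simp: ideal_set_def)
  then show ?thesis by (simp add: r_def)
qed

text \<open>Generators are a nonzero \<open>x\<close> and, at each of the finitely many zeros of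
  \<open>x\<close>, an element of \<open>J\<close> of least value; \<open>ideal_membership\<close>
  shows that they suffice. Generation is expressed by minimality among the ideals that contain
  \<open>G\<close>.\<close>

lemma ideal_finitely_generated:
  assumes J: "ideal_set A J"
  shows "\<exists>G. finite G \<and> G \<subseteq> J \<and> (\<forall>J'. ideal_set A J' \<and> G \<subseteq> J' \<longrightarrow> J \<subseteq> J')"
proof (cases "J \<subseteq> {0}")
  case True
  then show ?thesis by (intro exI[of _ "{}"]) (auto simp: ideal_set_def)
next
  case False
  then obtain x where x: "x \<in> J" "x \<noteq> 0" by auto
  have JA: "J \<subseteq> A" using J by (auto simp: ideal_set_def)
  define S where "S = {i \<in> I. v i x \<noteq> 0}"
  have S: "finite S" "S \<subseteq> I" using finite_support[OF x(2)] by (auto simp: S_def)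
  have "\<forall>i\<in>S. \<exists>y\<in>J. y \<noteq> 0 \<and> (\<forall>a\<in>J. a \<noteq> 0 \<longrightarrow> v i y \<le> v i a)"
  proof
    fix i assume "i \<in> S"
    then have i: "i \<in> I" using S by auto
    let ?P = "\<lambda>y. y \<in> J \<and> y \<noteq> 0"
    define y where "y = arg_min (\<lambda>y. nat (v i y)) ?P"
    have y: "?P y" unfolding y_def by (rule arg_min_natI) (use x in auto)
    have "v i y \<le> v i a" if "a \<in> J" "a \<noteq> 0" for a
    proof -
      have "nat (v i y) \<le> nat (v i a)"
        unfolding y_def by (rule arg_min_nat_le) (use that in auto)
      then show ?thesis using A_v_nonneg[OF _ i, of a] A_v_nonneg[OF _ i, of y] that y JA by auto
    qed
    then show "\<exists>y\<in>J. y \<noteq> 0 \<and> (\<forall>a\<in>J. a \<noteq> 0 \<longrightarrow> v i y \<le> v i a)" using y by auto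
  qed
  then obtain y where y: "\<And>i. i \<in> S \<Longrightarrow> y i \<in> J" "\<And>i. i \<in> S \<Longrightarrow> y i \<noteq> 0"
    "\<And>i a. i \<in> S \<Longrightarrow> a \<in> J \<Longrightarrow> a \<noteq> 0 \<Longrightarrow> v i (y i) \<le> v i a" by metis
  have "J \<subseteq> J'" if J': "ideal_set A J'" "insert x (y ` S) \<subseteq> J'" for J'
  proof
    fix a assume a: "a \<in> J"
    show "a \<in> J'"
    proof (cases "a = 0")
      case True
      then show ?thesis using J' by (auto simp: ideal_set_def)
    next
      case False
      show ?thesis
      proof (rule ideal_membership[OF J'(1) _ x(2)])
        fix i assume "i \<in> I" "v i x \<noteq> 0"
        then have "i \<in> S" by (simp add: S_def)
        then show "\<exists>b\<in>J'. b \<noteq> 0 \<and> v i b \<le> v i a"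
          using J'(2) y a False by (intro bexI[of _ "y i"]) auto
      qed (use J' a False JA in auto)
    qed
  qed
  then show ?thesis
    using x y S by (intro exI[of _ "insert x (y ` S)"]) auto
qed

text \<open>If every place had a nonzero element of \<open>J\<close> of value at most 0,
  \<open>ideal_membership\<close> with \<open>a = 1\<close> would put 1 into
  \<open>J\<close>.\<close>

lemma proper_ideal_center:
  assumes J: "ideal_set A J" "1 \<notin> J" and x: "x \<in> J" "x \<noteq> 0"
  shows "\<exists>i\<in>I. \<forall>y\<in>J. ge i 1 y"
proof (rule ccontr)
  assume "\<not> ?thesis"
  then have *: "\<And>i. i \<in> I \<Longrightarrow> \<exists>y\<in>J. \<not> ge i 1 y" by auto
  have "1 \<in> J"
  proof (rule ideal_membership[OF J(1) x])
    fix i assume i: "i \<in> I"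
    then show "\<exists>y\<in>J. y \<noteq> 0 \<and> v i y \<le> v i 1"
      using *[OF i] by (force simp: ge_def)
  qed auto
  with J show False by simp
qed

text \<open>The larger ideal \<open>Q\<close> has a center \<open>i\<close>. For nonzero
  \<open>a\<close> in \<open>Q\<close> some \<open>a ^ m * b\<close> is a multiple of
  \<open>x\<close>, where \<open>b\<close> is a unit at \<open>i\<close> and hence outside
  \<open>Q\<close>; primality then puts \<open>a\<close> into \<open>P\<close>.\<close>

lemma nonzero_prime_maximal:
  assumes P: "ideal_set A P" and prime: "\<And>a b. a \<in> A \<Longrightarrow> b \<in> A \<Longrightarrow> a * b \<in> P \<Longrightarrow> a \<in> P \<or> b \<in> P"
    and x: "x \<in> P" "x \<noteq> 0" and Q: "ideal_set A Q" "1 \<notin> Q" "P \<subseteq> Q"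
  shows "Q = P"
proof
  show "Q \<subseteq> P"
  proof
    fix a assume a: "a \<in> Q"
    obtain i where i: "i \<in> I" "\<And>y. y \<in> Q \<Longrightarrow> ge i 1 y"
      using proper_ideal_center[OF Q(1,2)] x Q(3) by blast
    have QA: "Q \<subseteq> A" and aA: "a \<in> A" and xA: "x \<in> A"
      using Q a P x by (auto simp: ideal_set_def)
    show "a \<in> P"
    proof (cases "a = 0")
      case True
      then show ?thesis using P by (auto simp: ideal_set_def)
    next
      case a0: False
      define S where "S = {i \<in> I. v i x \<noteq> 0}"
      have S: "finite S" "S \<subseteq> I" using finite_support[OF x(2)] by (auto simp: S_def)
      define m where "m = nat (\<Sum>i\<in>S. v i x)"
      have vx: "v j x \<le> int m" if "j \<in> I" for j
      proof (cases "j \<in> S")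
        case True
        have "v j x \<le> (\<Sum>i\<in>S. v i x)"
          by (rule member_le_sum) (use True S xA x A_v_nonneg in auto)
        then show ?thesis unfolding m_def by simp
      qed (use that in \<open>auto simp: S_def\<close>)
      obtain b where b: "b \<in> A" "b \<noteq> 0" "v i b = 0" "\<forall>j\<in>S - {i}. int m \<le> v j b"
        using multiple_avoiding[OF i(1), of "S - {i}" m] S by blast
      have bQ: "b \<notin> Q" using i(2)[of b] b by (auto simp: ge_def)
      have "ge j 0 (a ^ m * b / x)" if j: "j \<in> I" for j
      proof -
        have eq: "v j (a ^ m * b / x) = int m * v j a + v j b - v j x"
          using a0 b x j by (simp add: v_mult v_divide v_power)
        have nn: "0 \<le> int m * v j a" "0 \<le> v j b"
          using A_v_nonneg[OF aA j a0] A_v_nonneg[OF b(1) j b(2)] by auto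
        consider "j = i" | "j \<in> S - {i}" | "j \<notin> S" by auto
        then have "0 \<le> int m * v j a + v j b - v j x"
        proof cases
          case 1
          have "1 \<le> v i a" using i(2)[OF a] a0 by (auto simp: ge_def)
          then have "int m * 1 \<le> int m * v i a" by (intro mult_left_mono) auto
          then show ?thesis using vx[OF j] nn 1 by simp
        next
          case 2
          then have "int m \<le> v j b" using b(4) by blast
          then show ?thesis using vx[OF j] nn by linarith
        next
          case 3
          then show ?thesis using nn j by (auto simp: S_def)
        qed
        then show ?thesis using eq by (simp add: ge_def)
      qed
      then have "a ^ m * b / x \<in> A" by (auto simp: ring_at_def)
      then have "(a ^ m * b / x) * x \<in> P" using P x unfolding ideal_set_def by blast
      then have "a ^ m * b \<in> P" using x by simp
      then have "a ^ m \<in> P"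
        using prime[of "a ^ m" b] b bQ Q(3) aA ring_at_power[of I a m] by auto
      then show "a \<in> P"
      proof (induction m)
        case 0
        then show ?case using Q by auto
      next
        case (Suc m)
        then show ?case using prime[of a "a ^ m"] aA ring_at_power[of I a m] by auto
      qed
    qed
  qed
qed (rule Q)

text \<open>At a pole of \<open>x\<close> the value of \<open>x ^ n\<close> is strictly smaller than
  that of every nonzero term on the right.\<close>

lemma integral_closed:
  assumes c: "\<And>k. k < n \<Longrightarrow> c k \<in> A" and x: "x ^ n = (\<Sum>k<n. c k * x ^ k)"
  shows "x \<in> A"
proof -
  have "ge i 0 x" if i: "i \<in> I" for i
  proof (rule ccontr)
    assume "\<not> ge i 0 x"
    then have x0: "x \<noteq> 0" and neg: "v i x < 0" by (auto simp: ge_def)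
    \<comment> \<open>For \<open>n = 0\<close> the equation would read \<open>1 = 0\<close>.\<close>
    have n0: "n \<noteq> 0" using x by (metis lessThan_0 power_0 sum.empty zero_neq_one)
    have "ge i ((int n - 1) * v i x) (\<Sum>k<n. c k * x ^ k)"
    proof (rule ge_sum[OF i])
      fix k assume k: "k \<in> {..<n}"
      have "(int n - 1) * v i x \<le> int k * v i x"
        using neg k by (intro mult_right_mono_neg) auto
      then have "ge i ((int n - 1) * v i x) (x ^ k)"
        using x0 i by (auto simp: ge_def v_power)
      then show "ge i ((int n - 1) * v i x) (c k * x ^ k)"
        using ge_mult_left[OF i A_ge[OF c i]] k by auto
    qed
    then have "ge i ((int n - 1) * v i x) (x ^ n)" using x by simp
    then have "(int n - 1) * v i x \<le> int n * v i x"
      using x0 i by (auto simp: ge_def v_power)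
    then show False using neg by (simp add: algebra_simps)
  qed
  then show ?thesis by (auto simp: ring_at_def)
qed

text \<open>\<open>J\<close> consists of the places where all of \<open>D\<close> is integral. For
  \<open>x\<close> integral on \<open>J\<close>, a proper conductor \<open>C\<close> would have a
  center \<open>i\<close>; dividing \<open>x\<close> by an element of \<open>D\<close> makes it
  integral at \<open>i\<close>, and \<open>denominator_avoiding\<close> then produces a member of
  \<open>C\<close> that is a unit at \<open>i\<close>.\<close>

lemma overring_is_ring_at:
  assumes D: "subring_set D" "A \<subseteq> D"
  shows "\<exists>J\<subseteq>I. D = ring_at J"
proof -
  define J where "J = {i \<in> I. \<forall>d\<in>D. ge i 0 d}"
  have D_pow: "d ^ n \<in> D" if "d \<in> D" for d n
    using that D by (induction n) (auto simp: subring_set_def)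
  have "x \<in> D" if x: "x \<in> ring_at J" for x
  proof -
    define C where "C = {a \<in> A. a * x \<in> D}"
    have "0 \<in> D" using D by auto
    then have C: "ideal_set A C"
      using D unfolding ideal_set_def C_def subring_set_def
      by (auto simp: distrib_right mult.assoc intro: ring_at_closed)
    have "1 \<in> C"
    proof (rule ccontr)
      assume "1 \<notin> C"
      moreover obtain a b where ab: "a \<in> A" "b \<in> A" "b \<noteq> 0" "x = a / b"
        using fraction[of x] by auto
      then have "b \<in> C" using D by (auto simp: C_def)
      ultimately obtain i where i: "i \<in> I" "\<And>y. y \<in> C \<Longrightarrow> ge i 1 y"
        using proper_ideal_center[OF C _ _ ab(3)] by blast
      have "\<exists>d\<in>D. d \<noteq> 0 \<and> ge i 0 (x / d)"
      proof (cases "i \<in> J")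
        case True
        then have "ge i 0 x" using x by (auto simp: ring_at_def)
        then show ?thesis using D by (intro bexI[of _ 1]) (auto simp: subring_set_def)
      next
        case False
        then obtain d where d: "d \<in> D" "\<not> ge i 0 d" using i by (auto simp: J_def)
        then have d0: "d \<noteq> 0" "v i d < 0" by (auto simp: ge_def)
        \<comment> \<open>Each factor \<open>d\<close> has a pole of order at least 1 at
          \<open>i\<close>, so \<open>n\<close> of them absorb the pole of \<open>x\<close>.\<close>
        define n where "n = nat (- v i x)"
        have "ge i 0 (x / d ^ n)"
        proof (cases "x = 0")
          case False
          have "int n * v i d \<le> int n * (-1)" using d0 by (intro mult_left_mono) auto
          then have "int n * v i d \<le> v i x" unfolding n_def by auto
          then show ?thesis using False d0 i by (simp add: ge_def v_divide v_power)
        qed auto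
        moreover have "d ^ n \<noteq> 0" using d0 by simp
        ultimately show ?thesis using D_pow[OF d(1), of n] by blast
      qed
      then obtain d where d: "d \<in> D" "d \<noteq> 0" "ge i 0 (x / d)" by auto
      obtain a where a: "a \<in> A" "a \<noteq> 0" "v i a = 0" "a * (x / d) \<in> A"
        using denominator_avoiding[OF i(1) d(3)] by auto
      have "a * (x / d) * d \<in> D" using a(4) d(1) D unfolding subring_set_def by blast
      then have "a \<in> C" using a d by (auto simp: C_def)
      then show False using i(2)[of a] a by (auto simp: ge_def)
    qed
    then show ?thesis by (simp add: C_def)
  qed
  moreover have "D \<subseteq> ring_at J" unfolding J_def ring_at_def by blast
  ultimately have "D = ring_at J" by blast
  then show ?thesis by (intro exI[of _ J]) (auto simp: J_def)
qed

end

section \<open>Overrings and weighted product formulas\<close>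

text \<open>\<open>product_formula\<close> and \<open>principal\<close> together state that a
  finitely supported divisor is the divisor of an element exactly when its weighted degree is 0: the
  degree identifies the class group with a subgroup of the integers.\<close>

locale weighted_family = dedekind_family I v
  for I :: "'i set" and v :: "'i \<Rightarrow> 'k::field \<Rightarrow> int" +
  fixes w :: "'i \<Rightarrow> int"
  assumes weight_nonzero: "i \<in> I \<Longrightarrow> w i \<noteq> 0"
    and product_formula: "x \<noteq> 0 \<Longrightarrow> (\<Sum>i | i \<in> I \<and> v i x \<noteq> 0. w i * v i x) = 0"
    and principal: "finite {i \<in> I. n i \<noteq> 0} \<Longrightarrow> (\<Sum>i | i \<in> I \<and> n i \<noteq> 0. w i * n i) = 0 \<Longrightarrow>
      \<exists>x. x \<noteq> 0 \<and> (\<forall>i\<in>I. v i x = n i)"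
    and two_positive: "\<exists>p\<in>I. \<exists>q\<in>I. p \<noteq> q \<and> 0 < w p \<and> 0 < w q"
    and two_negative: "\<exists>p\<in>I. \<exists>q\<in>I. p \<noteq> q \<and> w p < 0 \<and> w q < 0"
begin

text \<open>By this symmetry each fact about \<open>neg\<close> yields one about
  \<open>pos\<close>.\<close>

lemma uminus_weighted: "weighted_family I v (\<lambda>i. - w i)"
proof unfold_locales
  show "\<exists>x. x \<noteq> 0 \<and> (\<forall>i\<in>I. v i x = n i)"
    if "finite {i \<in> I. n i \<noteq> 0}" "(\<Sum>i | i \<in> I \<and> n i \<noteq> 0. - w i * n i) = 0" for n
    using that by (intro principal) (auto simp: sum_negf)
qed (use weight_nonzero product_formula two_positive two_negative in \<open>auto simp: sum_negf\<close>)

section \<open>Divisors of degree zero and the signs of the weights\<close>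

lemma product_formula_superset:
  assumes "x \<noteq> 0" "finite S" "S \<subseteq> I" "\<And>i. i \<in> I \<Longrightarrow> v i x \<noteq> 0 \<Longrightarrow> i \<in> S"
  shows "(\<Sum>i\<in>S. w i * v i x) = 0"
proof -
  have "(\<Sum>i\<in>S. w i * v i x) = (\<Sum>i | i \<in> I \<and> v i x \<noteq> 0. w i * v i x)"
    by (rule sum.mono_neutral_right) (use assms in auto)
  then show ?thesis using product_formula[OF assms(1)] by simp
qed

lemma principal_superset:
  assumes "finite S" "S \<subseteq> I" "(\<Sum>i\<in>S. w i * n i) = 0" "\<And>i. i \<in> I - S \<Longrightarrow> n i = 0"
  shows "\<exists>x. x \<noteq> 0 \<and> (\<forall>i\<in>I. v i x = n i)"
proof (rule principal)
  show "finite {i \<in> I. n i \<noteq> 0}"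
    by (rule finite_subset[OF _ assms(1)]) (use assms(4) in auto)
  have "(\<Sum>i | i \<in> I \<and> n i \<noteq> 0. w i * n i) = (\<Sum>i\<in>S. w i * n i)"
    by (rule sum.mono_neutral_left) (use assms in auto)
  then show "(\<Sum>i | i \<in> I \<and> n i \<noteq> 0. w i * n i) = 0" using assms(3) by simp
qed

definition "pos = {i \<in> I. 0 < w i}"
definition "neg = {i \<in> I. w i < 0}"

lemma pos_neg: "I = pos \<union> neg" "pos \<inter> neg = {}" "pos \<subseteq> I" "neg \<subseteq> I"
  using weight_nonzero by (force simp: pos_def neg_def)+

text \<open>The divisor \<open>w q * p - w p * q\<close> has degree 0.\<close>

lemma two_prime_element:
  assumes "p \<in> I" "q \<in> I" "p \<noteq> q"
  shows "\<exists>x. x \<noteq> 0 \<and> (\<forall>i\<in>I. v i x = (if i = p then w q else if i = q then - w p else 0))"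
  by (rule principal_superset[of "{p, q}"]) (use assms in auto)

text \<open>A nonzero effective divisor supported in \<open>pos\<close> has positive degree.\<close>

lemma no_effective_pos:
  assumes "x \<noteq> 0" "\<And>i. i \<in> neg \<Longrightarrow> v i x = 0" "\<And>i. i \<in> pos \<Longrightarrow> 0 \<le> v i x" "i \<in> I"
  shows "v i x = 0"
proof (rule ccontr)
  assume "v i x \<noteq> 0"
  let ?S = "{i \<in> I. v i x \<noteq> 0}"
  have "i \<in> ?S" using assms \<open>v i x \<noteq> 0\<close> by auto
  have "0 < w j * v j x" if "j \<in> ?S" for j
  proof -
    have "j \<in> pos" using that assms(2) pos_neg by auto
    then show ?thesis using that assms(3)[of j] by (auto simp: pos_def)
  qed
  then have "0 < (\<Sum>i\<in>?S. w i * v i x)"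
    by (intro sum_pos) (use finite_support[OF assms(1)] \<open>i \<in> ?S\<close> in auto)
  then show False using product_formula[OF assms(1)] by simp
qed

text \<open>The elements of \<open>A\<close> that are units at all places of \<open>J\<close> form
  the multiplicative set; products of powers of the given \<open>s\<close> clear the finitely many
  poles of any \<open>x\<close> in \<open>ring_at J\<close>.\<close>

lemma localization_criterion:
  assumes J: "J \<subseteq> I"
    and s: "\<And>i. i \<in> I - J \<Longrightarrow> \<exists>s\<in>A. s \<noteq> 0 \<and> (\<forall>j\<in>J. v j s = 0) \<and> 0 < v i s"
  shows "localization_set A (ring_at J)"
proof -
  define S where "S = {s \<in> A. s \<noteq> 0 \<and> (\<forall>j\<in>J. v j s = 0)}"
  have S_mult: "a * b \<in> S" if "a \<in> S" "b \<in> S" for a b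
    using that J by (auto simp: S_def v_mult subset_iff intro: ring_at_closed)
  have S_pow: "a ^ n \<in> S" if "a \<in> S" for a n
    by (induction n) (use that S_mult J in \<open>auto simp: S_def\<close>)
  have *: "\<exists>s\<in>S. \<forall>i\<in>F. int m \<le> v i s" if "finite F" "F \<subseteq> I - J" for F m
    using that
  proof (induction F rule: finite_induct)
    case empty
    then show ?case using J by (intro bexI[of _ 1]) (auto simp: S_def)
  next
    case (insert i F)
    then obtain a where a: "a \<in> S" "\<forall>i\<in>F. int m \<le> v i a" by auto
    obtain b where b: "b \<in> S" "0 < v i b" using s[of i] insert by (auto simp: S_def)
    have "int m \<le> v j (a * b ^ m)" if "j \<in> insert i F" for j
    proof -
      have j: "j \<in> I" using that insert by auto
      have eq: "v j (a * b ^ m) = v j a + int m * v j b"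
        using a b j by (simp add: v_mult v_power S_def)
      have nn: "0 \<le> v j a" "0 \<le> v j b"
        using a b j A_v_nonneg by (auto simp: S_def)
      show ?thesis
      proof (cases "j = i")
        case True
        have "int m * 1 \<le> int m * v i b" using b(2) by (intro mult_left_mono) auto
        then show ?thesis using eq nn True by simp
      next
        case False
        then have "int m \<le> v j a" using that a by auto
        moreover have "0 \<le> int m * v j b" using nn by simp
        ultimately show ?thesis using eq by linarith
      qed
    qed
    then show ?case using S_mult[OF a(1) S_pow[OF b(1)]] by blast
  qed
  have "\<exists>a\<in>A. \<exists>s\<in>S. x = a / s" if x: "x \<in> ring_at J" for x
  proof (cases "x = 0")
    case True
    then show ?thesis using J by (intro bexI[of _ 0] bexI[of _ 1]) (auto simp: S_def)
  next
    case False
    define F where "F = {i \<in> I. v i x < 0}"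
    have F: "finite F"
      by (rule finite_subset[OF _ finite_support[OF False]]) (auto simp: F_def)
    have FJ: "F \<subseteq> I - J"
      using x False by (auto simp: F_def ring_at_def ge_def)
    define m where "m = (\<Sum>j\<in>F. nat (- v j x))"
    obtain t where t: "t \<in> S" "\<forall>i\<in>F. int m \<le> v i t" using *[OF F FJ, of m] by auto
    have "ge j 0 (x * t)" if j: "j \<in> I" for j
    proof (cases "j \<in> F")
      case True
      then have "nat (- v j x) \<le> m"
        unfolding m_def by (rule member_le_sum) (use F in auto)
      moreover have "int m \<le> v j t" using t True by auto
      ultimately show ?thesis using t False j by (simp add: ge_def v_mult S_def)
    next
      case nF: False
      then have "0 \<le> v j x" using j by (auto simp: F_def)
      then show ?thesis using t False j A_v_nonneg[of t j] by (simp add: ge_def v_mult S_def)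
    qed
    then have "x * t \<in> A" by (auto simp: ring_at_def)
    then show ?thesis using t by (intro bexI[of _ "x * t"] bexI[of _ t]) (auto simp: S_def)
  qed
  moreover have "a / s \<in> ring_at J" if a: "a \<in> A" and s: "s \<in> S" for a s
  proof -
    have "ge j 0 (a / s)" if "j \<in> J" for j
    proof -
      have "j \<in> I" "v j s = 0" "s \<noteq> 0" using that J s by (auto simp: S_def)
      then show ?thesis using A_v_nonneg[OF a, of j] by (cases "a = 0") (auto simp: ge_def v_divide)
    qed
    then show ?thesis by (auto simp: ring_at_def)
  qed
  ultimately have "ring_at J = {a / s | a s. a \<in> A \<and> s \<in> S}" by blast
  then show ?thesis unfolding localization_set_def
    by (intro exI[of _ S]) (use S_mult J in \<open>auto simp: S_def\<close>)
qed

text \<open>For \<open>i\<close> positive and \<open>i'\<close> negative, both outside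
  \<open>J\<close>, the multiplicities \<open>- w i'\<close> at \<open>i\<close> and
  \<open>w i\<close> at \<open>i'\<close> give an effective divisor of degree 0. Its generator is a
  unit of \<open>ring_at J\<close> but not of \<open>A\<close>, and it feeds
  \<open>localization_criterion\<close>.\<close>

lemma mixed_complement:
  assumes J: "J \<subseteq> I" and p: "p \<in> pos - J" and q: "q \<in> neg - J"
  shows "localization_set A (ring_at J)" "unit_set (ring_at J) \<inter> A \<noteq> unit_set A"
proof -
  have *: "\<exists>s\<in>A. s \<noteq> 0 \<and> (\<forall>j\<in>J. v j s = 0) \<and> 0 < v i s \<and> 0 < v i' s"
    if i: "i \<in> pos - J" and i': "i' \<in> neg - J" for i i'
  proof -
    have w: "0 < w i" "w i' < 0" and I: "i \<in> I" "i' \<in> I" using i i' by (auto simp: pos_def neg_def)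
    then have ne: "i \<noteq> i'" by auto
    obtain s where s: "s \<noteq> 0" "\<forall>j\<in>I. v j s = (if j = i' then w i else if j = i then - w i' else 0)"
      using two_prime_element[OF I(2,1)] ne by metis
    have "s \<in> A" using s w by (auto simp: ring_at_def ge_def)
    then show ?thesis using s w i i' I J ne by (intro bexI[of _ s]) (auto simp: subset_iff)
  qed
  show "localization_set A (ring_at J)"
  proof (rule localization_criterion[OF J])
    fix i assume "i \<in> I - J"
    then have "i \<in> pos - J \<or> i \<in> neg - J" using pos_neg by auto
    then show "\<exists>s\<in>A. s \<noteq> 0 \<and> (\<forall>j\<in>J. v j s = 0) \<and> 0 < v i s"
      using *[OF _ q, of i] *[OF p, of i] by auto
  qed
  obtain s where "s \<in> A" "s \<noteq> 0" "\<forall>j\<in>J. v j s = 0" "0 < v p s"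
    using *[OF p q] by auto
  then have "s \<in> unit_set (ring_at J) \<inter> A" "s \<notin> unit_set A"
    using p J by (auto simp: unit_set_ring_at pos_def intro!: bexI[of _ p])
  then show "unit_set (ring_at J) \<inter> A \<noteq> unit_set A" by auto
qed

text \<open>The element \<open>d\<close> has its only zero at \<open>p\<close> and its only pole at
  \<open>q\<close>. A unit \<open>u\<close> of \<open>ring_at J\<close> that makes
  \<open>u * d ^ n\<close> integral is itself integral, hence has no zeros by
  \<open>no_effective_pos\<close>, and cannot cancel the pole.\<close>

lemma partial_complement:
  assumes J: "J \<subseteq> I" "neg \<subseteq> J" and p: "p \<in> pos \<inter> J" and q: "q \<in> I - J"
  shows "\<not> almost_well_centered_set A (ring_at J)"
proof
  assume awc: "almost_well_centered_set A (ring_at J)"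
  have qp: "q \<in> pos" using q J pos_neg by auto
  have w: "0 < w p" "0 < w q" and ne: "p \<noteq> q" and I: "p \<in> I" "q \<in> I"
    using p q qp by (auto simp: pos_def)
  obtain d where d: "d \<noteq> 0" "\<forall>j\<in>I. v j d = (if j = p then w q else if j = q then - w p else 0)"
    using two_prime_element[OF I ne] by auto
  have "d \<in> ring_at J" using d w J q by (auto simp: ring_at_def ge_def)
  then obtain n u where n: "n > 0" and u: "u \<in> unit_set (ring_at J)" "u * d ^ n \<in> A"
    using awc by (auto simp: almost_well_centered_set_def)
  have u0: "u \<noteq> 0" and uJ: "\<And>i. i \<in> J \<Longrightarrow> v i u = 0"
    using u(1) by (auto simp: unit_set_ring_at[OF J(1)])
  have nn: "0 \<le> v i u + int n * v i d" if "i \<in> I" for i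
    using A_v_nonneg[OF u(2) that] that u0 d(1) by (simp add: v_mult v_power)
  have "0 \<le> v i u" if "i \<in> pos" for i
  proof -
    have i: "i \<in> I" using that pos_neg by auto
    show ?thesis
    proof (cases "i \<in> J")
      case False
      then have "v i d \<le> 0" using i d(2) w p by auto
      then have "int n * v i d \<le> 0" by (simp add: mult_nonneg_nonpos)
      then show ?thesis using nn[OF i] by linarith
    qed (use uJ in auto)
  qed
  then have "v q u = 0" using no_effective_pos[OF u0 _ _ I(2)] uJ J by auto
  moreover have "int n * v q d < 0" using n d(2) w ne I by (auto simp: mult_less_0_iff)
  ultimately show False using nn[OF I(2)] by simp
qed

text \<open>The negative part of the divisor of an element of \<open>ring_at neg\<close> is effective, so its
  positive part has degree \<open>m \<ge> 0\<close>; \<open>w p\<close> times that part is equivalent to \<open>m p\<close>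
  modulo units of \<open>ring_at neg\<close>.\<close>

lemma multiple_by_unit_integral:
  assumes p: "p \<in> pos" and d: "d \<in> ring_at neg"
  shows "\<exists>u\<in>unit_set (ring_at neg). u * d ^ nat (w p) \<in> A"
proof (cases "d = 0")
  case True
  have "1 \<in> unit_set (ring_at neg)" using pos_neg by (auto simp: unit_set_ring_at subset_iff)
  moreover have "nat (w p) \<noteq> 0" using p by (auto simp: pos_def)
  ultimately show ?thesis using True by (intro bexI[of _ 1]) (auto simp: zero_power)
next
  case False
  have wp: "0 < w p" and pI: "p \<in> I" using p by (auto simp: pos_def)
  \<comment> \<open>\<open>p\<close> is added because the unit constructed below may have a nonzero
    value there.\<close>
  define S where "S = insert p {i \<in> I. v i d \<noteq> 0}"
  have S: "finite S" "S \<subseteq> I" using finite_support[OF False] pI by (auto simp: S_def)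
  define m where "m = (\<Sum>i\<in>S \<inter> pos. w i * v i d)"
  have "(\<Sum>i\<in>S. w i * v i d) = 0"
    by (rule product_formula_superset) (use S False in \<open>auto simp: S_def\<close>)
  moreover have "S = (S \<inter> pos) \<union> (S \<inter> neg)" using S pos_neg by auto
  then have "(\<Sum>i\<in>S. w i * v i d) = m + (\<Sum>i\<in>S \<inter> neg. w i * v i d)"
    unfolding m_def using S pos_neg by (subst sum.union_disjoint[symmetric]) auto
  moreover have "(\<Sum>i\<in>S \<inter> neg. w i * v i d) \<le> 0"
    by (rule sum_nonpos) (use d False in \<open>auto simp: neg_def ring_at_def ge_def mult_nonpos_nonneg\<close>)
  ultimately have m: "0 \<le> m" by linarith
  define n where "n i = (if i \<in> S \<inter> pos then (if i = p then m else 0) - w p * v i d else 0)" for i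
  have "(\<Sum>i\<in>S. w i * n i) = (\<Sum>i\<in>S \<inter> pos. w i * n i)"
    by (rule sum.mono_neutral_right) (use S in \<open>auto simp: n_def\<close>)
  also have "\<dots> = (\<Sum>i\<in>S \<inter> pos. (if i = p then w p * m else 0) - w p * (w i * v i d))"
    by (rule sum.cong) (auto simp: n_def algebra_simps)
  also have "\<dots> = (\<Sum>i\<in>S \<inter> pos. if i = p then w p * m else 0) - w p * m"
    by (simp add: sum_subtractf m_def sum_distrib_left)
  also have "(\<Sum>i\<in>S \<inter> pos. if i = p then w p * m else 0) = w p * m"
    using S p by (subst sum.delta) (auto simp: S_def)
  finally have "(\<Sum>i\<in>S. w i * n i) = 0" by simp
  then obtain u where u: "u \<noteq> 0" "\<forall>i\<in>I. v i u = n i"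
    using principal_superset[OF S, of n] by (auto simp: n_def)
  have "u \<in> unit_set (ring_at neg)"
    unfolding unit_set_ring_at[OF pos_neg(4)] using u pos_neg(2,4) by (force simp: n_def)
  moreover have "ge i 0 (u * d ^ nat (w p))" if i: "i \<in> I" for i
  proof -
    have eq: "v i (u * d ^ nat (w p)) = n i + w p * v i d"
      using u False i wp by (simp add: v_mult v_power)
    consider "i \<in> S \<inter> pos" | "i \<in> neg" | "v i d = 0" "i \<notin> S"
      using i pos_neg by (auto simp: S_def)
    then have "0 \<le> n i + w p * v i d"
    proof cases
      case 2
      then have "i \<notin> pos" "0 \<le> v i d" using d False pos_neg by (auto simp: ring_at_def ge_def)
      then show ?thesis using wp by (simp add: n_def)
    qed (use m in \<open>auto simp: n_def\<close>)
    then show ?thesis using eq by (simp add: ge_def)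
  qed
  ultimately show ?thesis by (auto simp: ring_at_def)
qed

lemma almost_well_centered_ring_at_neg: "almost_well_centered_set A (ring_at neg)"
proof -
  obtain p where p: "p \<in> pos" using two_positive by (auto simp: pos_def)
  then have "nat (w p) > 0" by (simp add: pos_def)
  then show ?thesis
    using multiple_by_unit_integral[OF p] unfolding almost_well_centered_set_def by blast
qed

text \<open>With \<open>w p = 1\<close> the exponent in \<open>multiple_by_unit_integral\<close> is
  1.\<close>

lemma well_centered_ring_at_neg:
  assumes "p \<in> I" "w p = 1"
  shows "well_centered_set A (ring_at neg)"
  using multiple_by_unit_integral[of p] assms
  by (auto simp: well_centered_set_def pos_def)

text \<open>A denominator would be an element of \<open>A\<close> that is a unit at all negative
  places, hence of value 0 everywhere by \<open>no_effective_pos\<close>; but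
  \<open>ring_at neg\<close> contains an element with a pole at a positive place.\<close>

lemma not_localization_ring_at_neg: "\<not> localization_set A (ring_at neg)"
proof
  assume "localization_set A (ring_at neg)"
  then obtain S where S: "S \<subseteq> A - {0}" "1 \<in> S" "ring_at neg = {a / s | a s. a \<in> A \<and> s \<in> S}"
    by (auto simp: localization_set_def)
  obtain p q where pq: "p \<in> I" "q \<in> I" "p \<noteq> q" "0 < w p" "0 < w q"
    using two_positive by auto
  obtain x where x: "x \<noteq> 0" "\<forall>j\<in>I. v j x = (if j = p then w q else if j = q then - w p else 0)"
    using two_prime_element[OF pq(1-3)] by auto
  have "x \<in> ring_at neg" using x pq by (auto simp: ring_at_def ge_def neg_def)
  then obtain a s where as: "x = a / s" "a \<in> A" "s \<in> S" using S by auto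
  then have s0: "s \<noteq> 0" "s \<in> A" and a0: "a \<noteq> 0" using S x by auto
  have "1 / s \<in> ring_at neg" using S as zero_one_in_ring_at[of I] by blast
  then have "0 \<le> - v i s" if "i \<in> neg" for i
    using that s0 pos_neg v_divide[of i 1 s] by (force simp: ring_at_def ge_def)
  then have "v i s = 0" if "i \<in> neg" for i
    using that A_v_nonneg[OF s0(2) _ s0(1), of i] pos_neg by force
  moreover have "0 \<le> v i s" if "i \<in> pos" for i
    using that A_v_nonneg[OF s0(2) _ s0(1), of i] pos_neg by force
  ultimately have "v q s = 0" using no_effective_pos[OF s0(1)] pq by blast
  moreover have "v q x = v q a - v q s" using as a0 s0 pq by (simp add: v_divide)
  moreover have "0 \<le> v q a" using A_v_nonneg as pq a0 by auto
  ultimately show False using x pq by auto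
qed

text \<open>A unit of \<open>ring_at neg\<close> inside \<open>A\<close> has an effective divisor
  supported in \<open>pos\<close>, which must be 0.\<close>

lemma unit_set_ring_at_neg: "unit_set (ring_at neg) \<inter> A = unit_set A"
proof -
  have "v i x = 0" if "x \<noteq> 0" "\<forall>i\<in>neg. v i x = 0" "x \<in> A" "i \<in> I" for x i
    by (rule no_effective_pos) (use that A_v_nonneg pos_neg in auto)
  moreover have "x \<in> A" if "x \<noteq> 0" "\<forall>i\<in>I. v i x = 0" for x
    using that by (auto simp: ring_at_def ge_def)
  ultimately show ?thesis
    unfolding unit_set_ring_at[OF pos_neg(4)] unit_set_ring_at[OF order_refl]
    using pos_neg(4) by blast
qed

lemma ring_at_neg_neq: "ring_at neg \<noteq> A"
proof
  assume *: "ring_at neg = A"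
  have "localization_set A A"
    by (rule localization_criterion) auto
  then show False using * not_localization_ring_at_neg by simp
qed

text \<open>The divisor \<open>p + r - q\<close> has degree \<open>1 - 3 + 2 = 0\<close>. A unit
  multiple of its generator has value 1 at \<open>p\<close> and 0 at the other positive places, so
  integrality would require zeros at negative places of total degree -1, whereas each place with a
  zero contributes at most -2.\<close>

lemma not_well_centered_ring_at_pos:
  assumes "p \<in> I" "w p = 1" "q \<in> I" "w q = -2" "r \<in> I" "w r = -3" "\<And>i. i \<in> I \<Longrightarrow> w i \<noteq> -1"
  shows "\<not> well_centered_set A (ring_at pos)"
proof
  assume wc: "well_centered_set A (ring_at pos)"
  have ne: "p \<noteq> q" "p \<noteq> r" "q \<noteq> r" using assms by auto
  define n where "n i = (if i = p \<or> i = r then 1 else if i = q then -1 else 0 :: int)" for i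
  have "(\<Sum>i\<in>{p, q, r}. w i * n i) = 0" using ne assms by (simp add: n_def)
  then obtain d where d: "d \<noteq> 0" "\<forall>i\<in>I. v i d = n i"
    using principal_superset[of "{p, q, r}" n] assms by (auto simp: n_def)
  have "d \<in> ring_at pos" using d assms by (auto simp: n_def ring_at_def ge_def pos_def)
  then obtain u where u: "u \<in> unit_set (ring_at pos)" "u * d \<in> A"
    using wc by (auto simp: well_centered_set_def)
  have u0: "u \<noteq> 0" and u_pos: "\<And>i. i \<in> pos \<Longrightarrow> v i u = 0"
    using u(1) pos_neg by (auto simp: unit_set_ring_at)
  let ?e = "u * d"
  have e0: "?e \<noteq> 0" using u0 d by simp
  define S where "S = insert p {i \<in> I. v i ?e \<noteq> 0}"
  have S: "finite S" "S \<subseteq> I" using finite_support[OF e0] assms by (auto simp: S_def)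
  have ve: "v i ?e = v i u + n i" if "i \<in> I" for i using that u0 d by (simp add: v_mult)
  have e_pos: "v i ?e = n i" if "i \<in> pos" for i using that ve[of i] u_pos pos_neg by auto
  have vp: "v p ?e = 1" using e_pos[of p] assms by (auto simp: pos_def n_def)
  have le: "w i * v i ?e \<le> -2" if i: "i \<in> S - {p}" for i
  proof -
    have iI: "i \<in> I" and ie: "v i ?e \<noteq> 0" using i by (auto simp: S_def)
    have "i \<notin> pos"
    proof
      assume "i \<in> pos"
      then have "n i \<noteq> 0" "0 < w i" using e_pos ie by (auto simp: pos_def)
      then show False using assms i by (auto simp: n_def split: if_splits)
    qed
    then have "w i \<le> -2" using assms(7)[OF iI] weight_nonzero[OF iI] iI by (auto simp: pos_def)
    moreover have "1 \<le> v i ?e" using A_v_nonneg[OF u(2) iI e0] ie by linarith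
    ultimately show ?thesis using mult_mono'[of 2 "- w i" 1 "v i ?e"] by simp
  qed
  have "0 = (\<Sum>i\<in>S. w i * v i ?e)"
    by (rule product_formula_superset[symmetric]) (use S e0 in \<open>auto simp: S_def\<close>)
  also have "\<dots> = 1 + (\<Sum>i\<in>S - {p}. w i * v i ?e)"
    using sum.remove[OF S(1), of p "\<lambda>i. w i * v i ?e"] vp assms by (simp add: S_def)
  finally have eq: "(\<Sum>i\<in>S - {p}. w i * v i ?e) = -1" by simp
  show False
  proof (cases "S - {p} = {}")
    case True
    show ?thesis using eq unfolding True by simp
  next
    case False
    then obtain i where i: "i \<in> S - {p}" by auto
    have "(\<Sum>i\<in>S - {p}. w i * v i ?e) = w i * v i ?e + (\<Sum>i\<in>S - {p} - {i}. w i * v i ?e)"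
      using S i by (intro sum.remove) auto
    moreover have "(\<Sum>i\<in>S - {p} - {i}. w i * v i ?e) \<le> 0"
      using le by (intro sum_nonpos) fastforce
    ultimately show False using eq le[OF i] by linarith
  qed
qed

section \<open>Exchange of the signs and classification of the overrings\<close>

lemma ring_at_pos_as_neg: "weighted_family.neg I (\<lambda>i. - w i) = pos" "weighted_family.pos I (\<lambda>i. - w i) = neg"
  using uminus_weighted by (auto simp: weighted_family.neg_def weighted_family.pos_def pos_def neg_def)

lemmas ring_at_pos_facts =
  weighted_family.almost_well_centered_ring_at_neg[OF uminus_weighted, unfolded ring_at_pos_as_neg]
  weighted_family.not_localization_ring_at_neg[OF uminus_weighted, unfolded ring_at_pos_as_neg]
  weighted_family.unit_set_ring_at_neg[OF uminus_weighted, unfolded ring_at_pos_as_neg]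
  weighted_family.ring_at_neg_neq[OF uminus_weighted, unfolded ring_at_pos_as_neg]

lemma ring_at_pos_neq_neg: "ring_at pos \<noteq> ring_at neg"
proof
  assume "ring_at pos = ring_at neg"
  then have "ring_at neg = A" using pos_neg by (auto simp: ring_at_def)
  then show False using ring_at_neg_neq by simp
qed

text \<open>An overring is \<open>ring_at J\<close>. If \<open>J\<close> is none of
  \<open>I\<close>, \<open>pos\<close>, \<open>neg\<close>, then either \<open>J\<close> contains
  one sign class and a nonempty proper part of the other, which \<open>partial_complement\<close>
  excludes, or it misses places of both signs and \<open>mixed_complement\<close> applies.\<close>

lemma almost_well_centered_cases:
  assumes D: "subring_set D" "A \<subseteq> D" and awc: "almost_well_centered_set A D"
  shows "D = A \<or> D = ring_at pos \<or> D = ring_at neg \<or>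
    localization_set A D \<and> unit_set D \<inter> A \<noteq> unit_set A"
proof -
  obtain J where J: "J \<subseteq> I" "D = ring_at J" using overring_is_ring_at[OF D] by auto
  show ?thesis
  proof (cases "J = I \<or> J = pos \<or> J = neg")
    case False
    have "\<exists>p. p \<in> pos - J" if "neg \<subseteq> J" using False that J pos_neg by blast
    have "\<not> neg \<subseteq> J"
    proof
      assume "neg \<subseteq> J"
      moreover from this obtain p q where "p \<in> pos \<inter> J" "q \<in> I - J" using False J pos_neg by blast
      ultimately show False using partial_complement J awc by blast
    qed
    moreover have "\<not> pos \<subseteq> J"
    proof
      assume "pos \<subseteq> J"
      moreover from this obtain p q where "p \<in> neg \<inter> J" "q \<in> I - J" using False J pos_neg by blast
      ultimately show False
        using weighted_family.partial_complement[OF uminus_weighted, unfolded ring_at_pos_as_neg] J awc by blast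
    qed
    ultimately show ?thesis using mixed_complement[OF J(1)] J(2) by blast
  qed (use J in auto)
qed

lemma localization_A: "localization_set A A"
  by (rule localization_criterion) auto

lemma special_overrings:
  "{D. subring_set D \<and> A \<subseteq> D \<and> almost_well_centered_set A D \<and> \<not> localization_set A D}
     = {ring_at pos, ring_at neg}"
  "{D. subring_set D \<and> A \<subseteq> D \<and> D \<noteq> A \<and> almost_well_centered_set A D \<and> unit_set D \<inter> A = unit_set A}
     = {ring_at pos, ring_at neg}"
proof -
  have sub: "subring_set (ring_at pos)" "subring_set (ring_at neg)" "A \<subseteq> ring_at pos" "A \<subseteq> ring_at neg"
    using ring_at_subring ring_at_antimono pos_neg by auto
  show "{D. subring_set D \<and> A \<subseteq> D \<and> almost_well_centered_set A D \<and> \<not> localization_set A D}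
     = {ring_at pos, ring_at neg}"
  proof (rule Set.set_eqI, rule iffI)
    fix D assume "D \<in> {D. subring_set D \<and> A \<subseteq> D \<and> almost_well_centered_set A D \<and> \<not> localization_set A D}"
    then show "D \<in> {ring_at pos, ring_at neg}"
      using almost_well_centered_cases[of D] localization_A by auto
  qed (use sub ring_at_pos_facts(1,2) almost_well_centered_ring_at_neg not_localization_ring_at_neg in auto)
  show "{D. subring_set D \<and> A \<subseteq> D \<and> D \<noteq> A \<and> almost_well_centered_set A D \<and> unit_set D \<inter> A = unit_set A}
     = {ring_at pos, ring_at neg}"
  proof (rule Set.set_eqI, rule iffI)
    fix D assume "D \<in> {D. subring_set D \<and> A \<subseteq> D \<and> D \<noteq> A \<and> almost_well_centered_set A D \<and>
      unit_set D \<inter> A = unit_set A}"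
    then show "D \<in> {ring_at pos, ring_at neg}"
      using almost_well_centered_cases[of D] by auto
  next
    fix D assume "D \<in> {ring_at pos, ring_at neg}"
    then consider "D = ring_at pos" | "D = ring_at neg" by auto
    then show "D \<in> {D. subring_set D \<and> A \<subseteq> D \<and> D \<noteq> A \<and> almost_well_centered_set A D \<and>
      unit_set D \<inter> A = unit_set A}"
      by cases (simp_all add: sub ring_at_pos_facts(1,3,4) almost_well_centered_ring_at_neg
        unit_set_ring_at_neg ring_at_neg_neq)
  qed
qed

end

section \<open>Transport of a field along an injection\<close>

text \<open>The copy of the field \<open>'k\<close> on the range of an injection \<open>h\<close>;
  the operations decode with the inverse of \<open>h\<close>. It moves a type-based construction
  into a ring whose elements have another type.\<close>

definition field_ring :: "('k::field \<Rightarrow> 'r) \<Rightarrow> 'r ring" where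
  "field_ring h = \<lparr>carrier = range h, monoid.mult = (\<lambda>x y. h (inv_into UNIV h x * inv_into UNIV h y)), one = h 1,
     ring.zero = h 0, add = (\<lambda>x y. h (inv_into UNIV h x + inv_into UNIV h y))\<rparr>"

context
  fixes h :: "'k::field \<Rightarrow> 'r"
  assumes inj: "inj h"
begin

private abbreviation "K \<equiv> field_ring h"

lemma K_simps [simp]:
  "carrier K = range h" "\<one>\<^bsub>K\<^esub> = h 1" "\<zero>\<^bsub>K\<^esub> = h 0"
  "h x \<otimes>\<^bsub>K\<^esub> h y = h (x * y)" "h x \<oplus>\<^bsub>K\<^esub> h y = h (x + y)"
  by (simp_all add: field_ring_def inv_f_f[OF inj])

lemma h_eq [simp]: "h x = h y \<longleftrightarrow> x = y"
  using inj by (auto simp: inj_def)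

lemma field_K: "field K"
proof -
  have "cring K"
  proof (rule cringI)
    show "abelian_group K"
    proof (rule abelian_groupI)
      fix x assume "x \<in> carrier K"
      then obtain a where "x = h a" by auto
      then show "\<exists>y\<in>carrier K. y \<oplus>\<^bsub>K\<^esub> x = \<zero>\<^bsub>K\<^esub>"
        by (intro bexI[of _ "h (- a)"]) auto
    qed (auto simp: algebra_simps)
    show "comm_monoid K" by (rule comm_monoidI) (auto simp: algebra_simps)
  qed (auto simp: algebra_simps)
  then show ?thesis
  proof (rule cring.cring_fieldI2)
    fix a assume "a \<in> carrier K" "a \<noteq> \<zero>\<^bsub>K\<^esub>"
    then obtain x where "a = h x" "x \<noteq> 0" by auto
    then show "\<exists>b\<in>carrier K. a \<otimes>\<^bsub>K\<^esub> b = \<one>\<^bsub>K\<^esub>"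
      by (intro bexI[of _ "h (inverse x)"]) auto
  qed simp
qed

interpretation K: field K by (rule field_K)

lemma K_a_inv [simp]: "\<ominus>\<^bsub>K\<^esub> h x = h (- x)"
  by (rule sym, rule K.sum_zero_eq_neg) auto

lemma K_m_inv: "x \<noteq> 0 \<Longrightarrow> inv\<^bsub>K\<^esub> h x = h (inverse x)"
  by (rule sym, rule K.comm_inv_char[symmetric]) auto

lemma K_pow [simp]: "h x [^]\<^bsub>K\<^esub> (n::nat) = h (x ^ n)"
  by (induction n) (auto simp: mult.commute)

lemma subring_image: "subring (h ` D) K \<longleftrightarrow> subring_set D"
proof
  assume "subring (h ` D) K"
  note E = subringE[OF this]
  have hD: "h x \<in> h ` D \<longleftrightarrow> x \<in> D" for x by auto
  show "subring_set D"
    using E(3) E(5) E(6,7) unfolding subring_set_def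
    by (auto simp: hD) (metis hD K_simps K_a_inv)+
next
  assume "subring_set D"
  then show "subring (h ` D) K"
    by (intro K.subringI) (auto simp: subring_set_def)
qed

lemma units_in_image: "units_in K (h ` D) = h ` unit_set D"
proof -
  have "units_in K (h ` D) = {y \<in> h ` D. \<exists>x\<in>D. y \<otimes>\<^bsub>K\<^esub> h x = h 1}"
    unfolding Units_def by (auto simp: mult.commute)
  then show ?thesis unfolding unit_set_def by (auto intro!: imageI)
qed

lemma overring_image:
  "overring K (h ` B) D \<longleftrightarrow> (\<exists>D'. D = h ` D' \<and> subring_set D' \<and> B \<subseteq> D')"
proof
  assume *: "overring K (h ` B) D"
  then have "D \<subseteq> range h" using subringE(1)[of D K] by (simp add: overring_def)
  then obtain D' where D': "D = h ` D'" by (metis subset_imageE)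
  then show "\<exists>D'. D = h ` D' \<and> subring_set D' \<and> B \<subseteq> D'"
    using * subring_image inj by (auto simp: overring_def inj_image_subset_iff)
qed (auto simp: overring_def subring_image)

lemma well_centered_image: "well_centered K (h ` B) (h ` D) \<longleftrightarrow> well_centered_set B D"
  by (auto simp: well_centered_def well_centered_set_def units_in_image image_iff)

lemma almost_well_centered_image:
  "almost_well_centered K (h ` B) (h ` D) \<longleftrightarrow> almost_well_centered_set B D"
  by (auto simp: almost_well_centered_def almost_well_centered_set_def units_in_image image_iff)

lemma localization_image: "is_localization K (h ` B) (h ` D) \<longleftrightarrow> localization_set B D"
proof -
  have frac: "{a \<otimes>\<^bsub>K\<^esub> inv\<^bsub>K\<^esub> s | a s. a \<in> h ` B \<and> s \<in> h ` S} = h ` {a / s | a s. a \<in> B \<and> s \<in> S}"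
    if "S \<subseteq> B - {0}" for S
  proof -
    have eq: "h a \<otimes>\<^bsub>K\<^esub> inv\<^bsub>K\<^esub> h s = h (a / s)" if "s \<in> S" for a s
      using that \<open>S \<subseteq> B - {0}\<close> by (subst K_m_inv) (auto simp: divide_inverse)
    show ?thesis
    proof (rule Set.set_eqI, rule iffI)
      fix y assume "y \<in> {a \<otimes>\<^bsub>K\<^esub> inv\<^bsub>K\<^esub> s | a s. a \<in> h ` B \<and> s \<in> h ` S}"
      then obtain a s where "a \<in> B" "s \<in> S" "y = h a \<otimes>\<^bsub>K\<^esub> inv\<^bsub>K\<^esub> h s" by blast
      then show "y \<in> h ` {a / s | a s. a \<in> B \<and> s \<in> S}" using eq by blast
    next
      fix y assume "y \<in> h ` {a / s | a s. a \<in> B \<and> s \<in> S}"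
      then obtain a s where as: "a \<in> B" "s \<in> S" "y = h (a / s)" by blast
      then have "y = h a \<otimes>\<^bsub>K\<^esub> inv\<^bsub>K\<^esub> h s" using eq by simp
      then show "y \<in> {a \<otimes>\<^bsub>K\<^esub> inv\<^bsub>K\<^esub> s | a s. a \<in> h ` B \<and> s \<in> h ` S}" using as by blast
    qed
  qed
  show ?thesis
  proof
    assume "is_localization K (h ` B) (h ` D)"
    then obtain S where S: "S \<subseteq> h ` B - {h 0}" "h 1 \<in> S" "\<forall>s\<in>S. \<forall>t\<in>S. s \<otimes>\<^bsub>K\<^esub> t \<in> S"
      "h ` D = {a \<otimes>\<^bsub>K\<^esub> inv\<^bsub>K\<^esub> s | a s. a \<in> h ` B \<and> s \<in> S}"
      by (auto simp: is_localization_def)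
    then obtain S' where S': "S = h ` S'" by (metis Diff_subset subset_imageE subset_trans)
    have sub: "S' \<subseteq> B - {0}" using S S' by auto
    have "h ` D = h ` {a / s | a s. a \<in> B \<and> s \<in> S'}" using S(4) frac[OF sub] S' by simp
    then have "D = {a / s | a s. a \<in> B \<and> s \<in> S'}" using inj by (simp add: inj_image_eq_iff)
    moreover have "s * t \<in> S'" if "s \<in> S'" "t \<in> S'" for s t
    proof -
      have "h (s * t) \<in> h ` S'" using S(3) S' that by auto
      then show ?thesis by auto
    qed
    moreover have "1 \<in> S'" using S(2) S' by auto
    ultimately show "localization_set B D"
      unfolding localization_set_def using sub by (intro exI[of _ S'] conjI) auto
  next
    assume "localization_set B D"
    then obtain S where S: "S \<subseteq> B - {0}" "1 \<in> S" "\<forall>s\<in>S. \<forall>t\<in>S. s * t \<in> S"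
      "D = {a / s | a s. a \<in> B \<and> s \<in> S}"
      unfolding localization_set_def by blast
    show "is_localization K (h ` B) (h ` D)"
      unfolding is_localization_def
    proof (intro exI[of _ "h ` S"] conjI)
      show "h ` D = {a \<otimes>\<^bsub>K\<^esub> inv\<^bsub>K\<^esub> s |a s. a \<in> h ` B \<and> s \<in> h ` S}"
        unfolding frac[OF S(1)] S(4)[symmetric] ..
    qed (use S in auto)
  qed
qed

lemma ideal_image:
  assumes B: "subring_set B" and J: "ideal J (K\<lparr>carrier := h ` B\<rparr>)"
  obtains J' where "J = h ` J'" "ideal_set B J'"
proof -
  interpret J: ideal J "K\<lparr>carrier := h ` B\<rparr>" by (rule J)
  have "J \<subseteq> h ` B" using J.a_subset by simp
  then obtain J' where J': "J = h ` J'" "J' \<subseteq> B" by (metis subset_image_iff)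
  have hJ: "h x \<in> J \<longleftrightarrow> x \<in> J'" for x using J' by auto
  have "ideal_set B J'"
    unfolding ideal_set_def
  proof (intro conjI ballI)
    show "0 \<in> J'" using J.additive_subgroup_axioms additive_subgroup.zero_closed hJ by fastforce
    show "x + y \<in> J'" if "x \<in> J'" "y \<in> J'" for x y
      using additive_subgroup.a_closed[OF J.additive_subgroup_axioms, of "h x" "h y"] that
      by (simp add: hJ)
    show "a * x \<in> J'" if "a \<in> B" "x \<in> J'" for a x
      using J.I_l_closed[of "h x" "h a"] that by (simp add: hJ)
  qed (use J' in auto)
  then show ?thesis using that J' by blast
qed

text \<open>Coefficient lists start with the leading coefficient, so the powers of \<open>x\<close>
  are matched with \<open>rev p\<close>.\<close>

lemma eval_image: "K.eval (map h p) (h x) = h (\<Sum>k<length p. rev p ! k * x ^ k)"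
proof (induction p)
  case (Cons a p)
  have "(\<Sum>k<length p. rev p ! k * x ^ k) = (\<Sum>k<length p. rev (a # p) ! k * x ^ k)"
    by (rule sum.cong) (auto simp: nth_append)
  then show ?case using Cons by (simp add: nth_append add.commute)
qed simp

end

section \<open>Transport of the main properties to the copy of the field\<close>

lemma Collect_eq_image:
  assumes "\<And>x. P (f x) \<longleftrightarrow> Q x" "\<And>y. P y \<Longrightarrow> \<exists>x. y = f x"
  shows "Collect P = f ` Collect Q"
proof (rule subset_antisym; rule subsetI)
  fix y assume "y \<in> Collect P"
  moreover from this obtain x where "y = f x" using assms(2) by auto
  ultimately show "y \<in> f ` Collect Q" using assms(1) by auto
qed (use assms(1) in auto)

lemma (in weighted_family) exactly_two_special_image:
  assumes "inj h"
  shows "exactly_two_special (field_ring h) (h ` A)"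
proof -
  let ?K = "field_ring h"
  have eq: "h ` S = h ` T \<longleftrightarrow> S = T" for S T using assms by (rule inj_image_eq_iff)
  have first: "{D. overring ?K (h ` A) D \<and> almost_well_centered ?K (h ` A) D \<and> \<not> is_localization ?K (h ` A) D}
    = image (image h) {D. subring_set D \<and> A \<subseteq> D \<and> almost_well_centered_set A D \<and> \<not> localization_set A D}"
    by (auto simp: overring_image[OF assms] almost_well_centered_image[OF assms]
        localization_image[OF assms])
  have second: "{D. overring ?K (h ` A) D \<and> D \<noteq> h ` A \<and> almost_well_centered ?K (h ` A) D \<and>
        units_in ?K D \<inter> h ` A = units_in ?K (h ` A)}
    = image (image h) {D. subring_set D \<and> A \<subseteq> D \<and> D \<noteq> A \<and> almost_well_centered_set A D \<and>
        unit_set D \<inter> A = unit_set A}"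
    (is "{D. ?P D} = image (image h) {D. ?Q D}")
  proof -
    have units: "units_in ?K (h ` D) \<inter> h ` A = units_in ?K (h ` A) \<longleftrightarrow> unit_set D \<inter> A = unit_set A" for D
      unfolding units_in_image[OF assms] image_Int[OF assms, symmetric] eq ..
    have "?P (h ` D) \<longleftrightarrow> ?Q D" for D
      by (auto simp: overring_image[OF assms] almost_well_centered_image[OF assms] units eq)
    moreover have "\<exists>D'. D = h ` D'" if "?P D" for D
      using that unfolding overring_image[OF assms] by blast
    ultimately show ?thesis by (rule Collect_eq_image)
  qed
  show ?thesis
    unfolding exactly_two_special_def
  proof (intro exI conjI)
    show "h ` ring_at pos \<noteq> h ` ring_at neg" unfolding eq by (rule ring_at_pos_neq_neg)
  qed (unfold first second special_overrings image_insert image_empty, rule refl, rule refl)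
qed

lemma (in dedekind_family) dedekind_domain_image:
  assumes inj: "inj h"
  shows "dedekind_domain_in (field_ring h) (h ` A)"
proof -
  let ?K = "field_ring h" and ?B = "field_ring h\<lparr>carrier := h ` A\<rparr>"
  note simps = K_simps[OF inj] h_eq[OF inj]
  have A: "subring_set A" by (rule ring_at_subring) simp
  have sub: "subring (h ` A) ?K" using A by (simp add: subring_image[OF inj])
  interpret K: field ?K by (rule field_K[OF inj])
  interpret B: domain ?B by (rule K.subring_is_domain[OF sub])
  have "frac_field_of ?K (h ` A)"
    unfolding frac_field_of_def
  proof (intro conjI ballI)
    fix y assume "y \<in> carrier ?K"
    then obtain x where x: "y = h x" by (auto simp: simps)
    obtain a b where "a \<in> A" "b \<in> A" "b \<noteq> 0" "x = a / b" using fraction[of x] by auto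
    then show "\<exists>a\<in>h ` A. \<exists>b\<in>h ` A. b \<noteq> \<zero>\<^bsub>?K\<^esub> \<and> y = a \<otimes>\<^bsub>?K\<^esub> inv\<^bsub>?K\<^esub> b"
      using x by (intro bexI[of _ "h a"] bexI[of _ "h b"])
        (auto simp: simps K_m_inv[OF inj] divide_inverse)
  qed (use sub K.field_axioms in auto)
  moreover have "noetherian_domain ?B"
  proof -
    have "noetherian_ring ?B"
    proof
      fix J assume J: "ideal J ?B"
      then obtain J' where J': "J = h ` J'" "ideal_set A J'" using ideal_image[OF inj A] by metis
      obtain G where G: "finite G" "G \<subseteq> J'" "\<And>Q. ideal_set A Q \<Longrightarrow> G \<subseteq> Q \<Longrightarrow> J' \<subseteq> Q"
        using ideal_finitely_generated[OF J'(2)] by metis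
      have GA: "h ` G \<subseteq> carrier ?B" using G J' by (auto simp: ideal_set_def)
      have "J = Idl\<^bsub>?B\<^esub> (h ` G)"
      proof
        show "Idl\<^bsub>?B\<^esub> (h ` G) \<subseteq> J"
          by (rule B.genideal_minimal[OF J]) (use G J' in auto)
        obtain Q where Q: "Idl\<^bsub>?B\<^esub> (h ` G) = h ` Q" "ideal_set A Q"
          using ideal_image[OF inj A B.genideal_ideal[OF GA]] by metis
        have "h ` G \<subseteq> h ` Q" using B.genideal_self[OF GA] Q by simp
        then have "G \<subseteq> Q" using inj by (simp add: inj_image_subset_iff)
        then show "J \<subseteq> Idl\<^bsub>?B\<^esub> (h ` G)" using G(3)[OF Q(2)] Q J' by auto
      qed
      then show "\<exists>S\<subseteq>carrier ?B. finite S \<and> J = Idl\<^bsub>?B\<^esub> S" using GA G by blast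
    qed
    then show ?thesis by (intro noetherian_domain.intro B.domain_axioms)
  qed
  moreover have "integrally_closed_in ?K (h ` A)"
    unfolding integrally_closed_in_def
  proof (intro ballI allI impI, elim conjE)
    fix y p assume y: "y \<in> carrier ?K" and p: "polynomial\<^bsub>?K\<^esub> (h ` A) p" "p \<noteq> []"
      "hd p = \<one>\<^bsub>?K\<^esub>" "K.eval p y = \<zero>\<^bsub>?K\<^esub>"
    obtain x where x: "y = h x" using y by (auto simp: simps)
    have "set p \<subseteq> h ` A" using p by (auto simp: polynomial_def)
    define p' where "p' = map (inv_into UNIV h) p"
    have "map h p' = p"
      unfolding p'_def map_map
      by (rule map_idI) (use \<open>set p \<subseteq> h ` A\<close> in \<open>auto simp: f_inv_into_f\<close>)
    moreover have "set p' \<subseteq> A"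
      using \<open>set p \<subseteq> h ` A\<close> inv_f_f[OF inj] by (force simp: p'_def)
    ultimately have p': "p = map h p'" "set p' \<subseteq> A" by auto
    obtain q where q: "p' = 1 # q" using p p'(1) by (cases p') (auto simp: simps)
    let ?c = "\<lambda>k. rev q ! k"
    have "(\<Sum>k<length p'. rev p' ! k * x ^ k) = 0"
      using p(4) unfolding p' x eval_image[OF inj] by (simp add: simps)
    moreover have "(\<Sum>k<length q. (rev q @ [1]) ! k * x ^ k) = (\<Sum>k<length q. ?c k * x ^ k)"
      by (rule sum.cong) (auto simp: nth_append)
    ultimately have "(\<Sum>k<length q. ?c k * x ^ k) + x ^ length q = 0"
      by (simp add: q nth_append)
    \<comment> \<open>The monic equation solved for its leading power, the form used by
      \<open>integral_closed\<close>.\<close>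
    then have x_pow: "x ^ length q = (\<Sum>k<length q. - ?c k * x ^ k)"
      by (simp only: mult_minus_left sum_negf) (simp only: eq_neg_iff_add_eq_0 add.commute)
    have "- ?c k \<in> A" if "k < length q" for k
    proof -
      have "?c k \<in> set q" using that nth_mem[of k "rev q"] by simp
      then show ?thesis using p' q by (intro ring_at_closed) auto
    qed
    then have "x \<in> A" using x_pow by (rule integral_closed)
    then show "y \<in> h ` A" using x by simp
  qed
  moreover have "maximalideal P ?B" if P: "primeideal P ?B" and P0: "P \<noteq> {\<zero>\<^bsub>?K\<^esub>}" for P
  proof -
    interpret P: primeideal P ?B by (rule P)
    obtain P' where P': "P = h ` P'" "ideal_set A P'"
      using ideal_image[OF inj A P.ideal_axioms] by metis
    obtain x where x: "x \<in> P'" "x \<noteq> 0"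
      using P0 P' by (auto simp: simps ideal_set_def)
    have prime: "a \<in> P' \<or> b \<in> P'" if "a \<in> A" "b \<in> A" "a * b \<in> P'" for a b
      using P.I_prime[of "h a" "h b"] that P' by (auto simp: simps)
    show ?thesis
    proof (rule maximalidealI[OF P.ideal_axioms])
      show "carrier ?B \<noteq> P" by (rule P.I_notcarr)
      fix J assume J: "ideal J ?B" "P \<subseteq> J" "J \<subseteq> carrier ?B"
      obtain Q where Q: "J = h ` Q" "ideal_set A Q" using ideal_image[OF inj A J(1)] by metis
      have PQ: "P' \<subseteq> Q" using J(2) Q P' inj by (simp add: inj_image_subset_iff)
      show "J = P \<or> J = carrier ?B"
      proof (cases "1 \<in> Q")
        case True
        have "a \<in> Q" if "a \<in> A" for a
        proof -
          have "a * 1 \<in> Q" using Q(2) True that unfolding ideal_set_def by blast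
          then show ?thesis by simp
        qed
        then show ?thesis using Q by (auto simp: ideal_set_def)
      next
        case False
        then show ?thesis using nonzero_prime_maximal[OF P'(2) prime x Q(2) False PQ] P' Q by auto
      qed
    qed
  qed
  ultimately show ?thesis unfolding dedekind_domain_in_def by blast
qed

section \<open>Coefficientwise homomorphisms\<close>

text \<open>Supports unique factorization and gcds in polynomials over power series.\<close>

instance fps :: (field) semiring_gcd_mult_normalize ..

definition fps_map :: "('a::zero \<Rightarrow> 'b::zero) \<Rightarrow> 'a fps \<Rightarrow> 'b fps" where
  "fps_map g f = Abs_fps (\<lambda>n. g (f $ n))"

lemma fps_map_nth [simp]: "fps_map g f $ n = g (f $ n)"
  by (simp add: fps_map_def)

locale comm_ring_hom_map =
  fixes g :: "'a::comm_ring_1 \<Rightarrow> 'b::comm_ring_1"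
  assumes hom_one [simp]: "g 1 = 1"
    and hom_add [simp]: "g (x + y) = g x + g y"
    and hom_mult [simp]: "g (x * y) = g x * g y"
begin

lemma hom_zero [simp]: "g 0 = 0"
  using hom_add[of 0 0] by simp

lemma hom_uminus [simp]: "g (- x) = - g x"
  using hom_add[of x "- x"] by (simp add: eq_neg_iff_add_eq_0 add.commute)

lemma hom_sum: "g (sum f S) = (\<Sum>x\<in>S. g (f x))"
  by (induction S rule: infinite_finite_induct) auto

lemma hom_power [simp]: "g (x ^ n) = g x ^ n"
  by (induction n) auto

lemma fps_map_hom: "comm_ring_hom_map (fps_map g)"
proof
  show "fps_map g (x * y) = fps_map g x * fps_map g y" for x y
    by (rule fps_ext) (simp add: fps_mult_nth hom_sum)
qed (auto intro!: fps_ext)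

lemma map_poly_hom: "comm_ring_hom_map (map_poly g)"
proof
  show "map_poly g (p * q) = map_poly g p * map_poly g q" for p q
    by (rule poly_eqI) (simp add: coeff_map_poly coeff_mult hom_sum)
qed (auto intro!: poly_eqI simp: coeff_map_poly coeff_1)

text \<open>Comparing coefficients instead of using \<open>map_poly\<close> covers both a change of
  the coefficient ring and, with \<open>Q = P\<close>, endomorphisms that fix all
  coefficients.\<close>

lemma poly_fixed_coeffs:
  fixes P :: "'a poly"
  assumes "\<And>i. g (coeff P i) = coeff Q i"
  shows "g (poly P x) = poly Q (g x)"
  using assms
proof (induction P arbitrary: Q)
  case 0
  then have "Q = 0" by (intro poly_eqI) (metis coeff_0 hom_zero)
  then show ?case by simp
next
  case (pCons a P)
  obtain b R where Q: "Q = pCons b R" by (cases Q)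
  have "g (coeff P i) = coeff R i" for i using pCons(3)[of "Suc i"] by (simp add: Q)
  moreover have "g a = b" using pCons(3)[of 0] by (simp add: Q)
  ultimately show ?case using pCons(2) by (simp add: Q)
qed

end

lemma comm_ring_hom_map_comp:
  "comm_ring_hom_map g \<Longrightarrow> comm_ring_hom_map h \<Longrightarrow> comm_ring_hom_map (\<lambda>x. h (g x))"
  by (simp add: comm_ring_hom_map_def)

lemma comm_ring_hom_map_poly: "comm_ring_hom_map (\<lambda>p. poly p x)"
  by unfold_locales auto

lemma comm_ring_hom_map_fps_nth_0: "comm_ring_hom_map (\<lambda>f. f $ 0)"
  by unfold_locales auto

section \<open>Hensel's lemma for power series\<close>

text \<open>Polynomials in \<open>x\<close> of bounded degree, read as the coefficients of the
  powers of \<open>t\<close>, form a polynomial in \<open>x\<close> over the power series in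
  \<open>t\<close>.\<close>

lemma fps_poly_of_poly_seq:
  fixes G :: "nat \<Rightarrow> 'a::comm_ring_1 poly"
  assumes "\<And>n. degree (G n) \<le> d"
  shows "\<exists>g :: 'a fps poly. \<forall>i n. coeff g i $ n = coeff (G n) i"
proof -
  have "coeff (\<Sum>j\<le>d. monom (Abs_fps (\<lambda>n. coeff (G n) j)) j) i $ n = coeff (G n) i" for i n
  proof (cases "i \<le> d")
    case True
    then show ?thesis by (simp add: coeff_sum)
  next
    case False
    then have "coeff (G n) i = 0" using assms[of n] by (intro coeff_eq_0) auto
    then show ?thesis using False by (simp add: coeff_sum)
  qed
  then show ?thesis by blast
qed

text \<open>Multiplying the Bezout identity by \<open>r\<close> solves the equation; reducing
  \<open>s * r\<close> modulo \<open>g0\<close> bounds \<open>g\<close>, and the bound for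
  \<open>h\<close> follows by comparing degrees in \<open>g0 * h = r - g * h0\<close>.\<close>

lemma hensel_step:
  fixes g0 h0 r :: "'a::field poly"
  assumes bezout: "u * g0 + s * h0 = 1" and g0: "g0 \<noteq> 0" and r: "degree r \<le> degree g0 + d"
    and h0: "degree h0 \<le> d"
  shows "\<exists>g h. g * h0 + g0 * h = r \<and> degree g \<le> degree g0 \<and> degree h \<le> d"
proof -
  define g where "g = (s * r) mod g0"
  define h where "h = u * r + ((s * r) div g0) * h0"
  have "g * h0 + g0 * h = ((s * r) div g0 * g0 + g) * h0 + u * g0 * r"
    by (simp add: h_def algebra_simps)
  also have "\<dots> = s * r * h0 + u * g0 * r" by (simp add: g_def)
  also have "\<dots> = (u * g0 + s * h0) * r" by (simp add: algebra_simps)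
  finally have eq: "g * h0 + g0 * h = r" using bezout by simp
  have dg: "degree g \<le> degree g0"
    unfolding g_def using degree_mod_less[OF g0, of "s * r"] by auto
  have "degree h \<le> d"
  proof (cases "h = 0")
    case False
    have "degree (g * h0) \<le> degree g0 + d"
      using degree_mult_le[of g h0] dg h0 by linarith
    then have "degree (r - g * h0) \<le> degree g0 + d" using r by (intro degree_diff_le)
    moreover have "r - g * h0 = g0 * h" using eq by (simp add: algebra_simps)
    ultimately show ?thesis using degree_mult_eq[OF g0 False] by simp
  qed auto
  then show ?thesis using eq dg by blast
qed

text \<open>In powers of \<open>t\<close>, the \<open>n\<close>-th coefficients of \<open>g\<close>
  and \<open>h\<close> solve a linear equation with left-hand side
  \<open>G n * h0 + g0 * H n\<close> whose right-hand side involves only \<open>f\<close> and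
  earlier coefficients; \<open>hensel_step\<close> solves it with uniform degree bounds.\<close>

lemma hensel:
  fixes f :: "'a::field fps poly" and g0 h0 :: "'a poly"
  assumes f: "map_poly (\<lambda>c. c $ 0) f = g0 * h0" and bezout: "u * g0 + s * h0 = 1"
    and g0: "g0 \<noteq> 0" and h0: "h0 \<noteq> 0"
  shows "\<exists>g h. f = g * h \<and> map_poly (\<lambda>c. c $ 0) g = g0 \<and> map_poly (\<lambda>c. c $ 0) h = h0"
proof -
  define F where "F n = map_poly (\<lambda>c. c $ n) f" for n
  have F_coeff: "coeff (F n) i = coeff f i $ n" for n i
    by (simp add: F_def coeff_map_poly)
  have F_degree: "degree (F n) \<le> degree f" for n
    unfolding F_def by (rule map_poly_degree_leq)
  have F0: "F 0 = g0 * h0" using f by (simp add: F_def)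
  \<comment> \<open>The degree of \<open>f\<close> may exceed that of its reduction;
    \<open>h\<close> is allowed the whole surplus.\<close>
  define d where "d = degree f - degree g0"
  have deg: "degree f = degree g0 + d" "degree h0 \<le> d"
    using F_degree[of 0] degree_mult_eq[OF g0 h0] F0 by (auto simp: d_def)
  define P :: "(nat \<Rightarrow> 'a poly \<times> 'a poly) \<Rightarrow> nat \<Rightarrow> 'a poly \<times> 'a poly \<Rightarrow> bool" where
    "P S n r \<longleftrightarrow> degree (fst r) \<le> degree g0 \<and> degree (snd r) \<le> d \<and>
      (if n = 0 then r = (g0, h0)
       else fst r * h0 + g0 * snd r = F n - (\<Sum>i\<in>{0<..<n}. fst (S i) * snd (S (n - i))))" for S n r
  have "\<exists>S. \<forall>n. P S n (S n)"
  \<comment> \<open>Course-of-values recursion: the pair at \<open>n\<close> depends on all earlier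
    pairs.\<close>
  proof (rule dependent_wf_choice[where R = less_than])
    show "wf less_than" by simp
    show "P S n r = P T n r" if "\<And>m. (m, n) \<in> less_than \<Longrightarrow> S m = T m" for S T n r
    proof -
      have "(\<Sum>i\<in>{0<..<n}. fst (S i) * snd (S (n - i))) = (\<Sum>i\<in>{0<..<n}. fst (T i) * snd (T (n - i)))"
        using that by (intro sum.cong) auto
      then show ?thesis by (simp add: P_def)
    qed
    fix n S assume IH: "\<And>m. (m, n) \<in> less_than \<Longrightarrow> P S m (S m)"
    show "\<exists>r. P S n r"
    proof (cases "n = 0")
      case True
      then show ?thesis using deg by (intro exI[of _ "(g0, h0)"]) (simp add: P_def)
    next
      case False
      have "degree (\<Sum>i\<in>{0<..<n}. fst (S i) * snd (S (n - i))) \<le> degree g0 + d"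
      proof (rule degree_sum_le)
        fix i assume "i \<in> {0<..<n}"
        then have "P S i (S i)" "P S (n - i) (S (n - i))" using IH by auto
        then show "degree (fst (S i) * snd (S (n - i))) \<le> degree g0 + d"
          using degree_mult_le[of "fst (S i)" "snd (S (n - i))"] by (auto simp: P_def)
      qed auto
      then have "degree (F n - (\<Sum>i\<in>{0<..<n}. fst (S i) * snd (S (n - i)))) \<le> degree g0 + d"
        using F_degree[of n] deg by (intro degree_diff_le) auto
      from hensel_step[OF bezout g0 this deg(2)] False show ?thesis by (auto simp: P_def)
    qed
  qed
  then obtain S where S: "\<And>n. P S n (S n)" by auto
  define G H where "G n = fst (S n)" and "H n = snd (S n)" for n
  have degs: "degree (G n) \<le> degree g0" "degree (H n) \<le> d" for n
    using S[of n] by (auto simp: P_def G_def H_def)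
  have zero: "G 0 = g0" "H 0 = h0" using S[of 0] by (auto simp: P_def G_def H_def)
  have conv: "(\<Sum>i\<le>n. G i * H (n - i)) = F n" for n
  proof (cases "n = 0")
    case True
    then show ?thesis using zero F0 by simp
  next
    case False
    have "{..n} = insert 0 (insert n {0<..<n})" using False by auto
    then have "(\<Sum>i\<le>n. G i * H (n - i)) = g0 * H n + (G n * h0 + (\<Sum>i\<in>{0<..<n}. G i * H (n - i)))"
      using False zero by simp
    then show ?thesis using S[of n] False by (simp add: P_def G_def H_def algebra_simps)
  qed
  obtain g :: "'a fps poly" where g: "\<And>i n. coeff g i $ n = coeff (G n) i"
    using fps_poly_of_poly_seq[of G] degs by blast
  obtain h :: "'a fps poly" where h: "\<And>i n. coeff h i $ n = coeff (H n) i"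
    using fps_poly_of_poly_seq[of H] degs by blast
  have "coeff (g * h) m $ n = coeff f m $ n" for m n
  proof -
    have "coeff (g * h) m $ n = (\<Sum>i\<le>m. \<Sum>k\<le>n. coeff (G k) i * coeff (H (n - k)) (m - i))"
      by (simp add: coeff_mult fps_sum_nth fps_mult_nth g h atLeast0AtMost)
    also have "\<dots> = (\<Sum>k\<le>n. \<Sum>i\<le>m. coeff (G k) i * coeff (H (n - k)) (m - i))"
      by (rule sum.swap)
    also have "\<dots> = coeff (\<Sum>k\<le>n. G k * H (n - k)) m"
      by (simp add: coeff_sum coeff_mult)
    finally show ?thesis unfolding conv F_coeff .
  qed
  then have "f = g * h" by (intro poly_eqI fps_ext) simp
  moreover have "map_poly (\<lambda>c. c $ 0) g = g0" "map_poly (\<lambda>c. c $ 0) h = h0"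
    using zero by (auto intro!: poly_eqI simp: coeff_map_poly g h)
  ultimately show ?thesis by blast
qed

text \<open>The reduction splits into a power of \<open>x\<close> and a factor \<open>h0\<close>
  with \<open>poly h0 0 \<noteq> 0\<close>; the second root keeps \<open>h0\<close> nonconstant, and
  \<open>hensel\<close> lifts the splitting. A unit over the power series is a constant polynomial,
  so neither factor is one.\<close>

lemma reducible_if_two_residue_roots:
  fixes f :: "'a::field fps poly"
  assumes root0: "coeff f 0 $ 0 = 0" and nz: "map_poly (\<lambda>c. c $ 0) f \<noteq> 0"
    and root: "poly (map_poly (\<lambda>c. c $ 0) f) a = 0" "a \<noteq> 0"
  shows "\<not> irreducible f"
proof
  assume irr: "irreducible f"
  let ?f = "map_poly (\<lambda>c. c $ 0) f"
  define m where "m = order 0 ?f"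
  obtain h0 where h0: "?f = [:-0, 1:] ^ m * h0" "\<not> [:-0, 1:] dvd h0"
    using order_decomp[OF nz, of 0] unfolding m_def by blast
  define g0 :: "'a poly" where "g0 = [:0, 1:] ^ m"
  have eq: "?f = g0 * h0" using h0 by (simp add: g0_def)
  define c where "c = poly h0 0"
  have c: "c \<noteq> 0" using h0(2) by (simp add: poly_eq_0_iff_dvd c_def)
  have "poly ?f 0 = 0" using root0 by (simp add: poly_0_coeff_0 coeff_map_poly)
  then have "m \<noteq> 0" using nz unfolding m_def by (simp add: order_root)
  \<comment> \<open>Bezout coefficients: \<open>y\<close> vanishes at 0, so \<open>g0\<close>
    divides \<open>y ^ m\<close>, while \<open>h0\<close> divides \<open>1 - y ^ m\<close>.\<close>
  define y where "y = 1 - smult (1 / c) h0"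
  have "poly y 0 = 0" using c by (simp add: y_def c_def)
  then have "[:0, 1:] dvd y" using poly_eq_0_iff_dvd[of y 0] by simp
  then have "g0 dvd y ^ m" unfolding g0_def by (rule dvd_power_same)
  then obtain u where u: "y ^ m = g0 * u" by auto
  have "1 - y ^ m = smult (1 / c) h0 * (\<Sum>i<m. y ^ i)"
    using one_diff_power_eq[of y m] by (simp add: y_def)
  then have bezout: "u * g0 + (smult (1 / c) (\<Sum>i<m. y ^ i)) * h0 = 1"
    unfolding u by (simp add: algebra_simps)
  have g0_nz: "g0 \<noteq> 0" by (simp add: g0_def)
  have h0_nz: "h0 \<noteq> 0" using nz eq by auto
  obtain g h where gh: "f = g * h" "map_poly (\<lambda>c. c $ 0) g = g0" "map_poly (\<lambda>c. c $ 0) h = h0"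
    using hensel[OF eq bezout g0_nz h0_nz] by auto
  have unit: "degree (map_poly (\<lambda>c. c $ 0) p) = 0" if "p dvd 1" for p :: "'a fps poly"
  proof -
    have "degree p = 0" using that by (auto simp: is_unit_poly_iff)
    then show ?thesis using map_poly_degree_leq[of "\<lambda>c. c $ 0" p] by simp
  qed
  have "degree g0 = m" by (simp add: g0_def degree_power_eq)
  moreover have "poly h0 a = 0" using root eq by (simp add: g0_def)
  then have "degree h0 \<noteq> 0"
    using h0_nz by (metis degree_eq_zeroE poly_pCons poly_0 mult_zero_right add.right_neutral pCons_0_0)
  ultimately show False
    using Factorial_Ring.irreducibleD[OF irr gh(1)] unit[of g] unit[of h] gh \<open>m \<noteq> 0\<close> by auto
qed

section \<open>Arcs over the algebraic closure of the two-element field\<close>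

lemma finite_bit_polys: "finite {q :: bit poly. degree q \<le> d}"
proof -
  have "(UNIV :: bit set) = {0, 1}"
    using bit_not_zero_iff by auto
  then have fin: "finite (UNIV :: bit set)" by (metis finite.emptyI finite.insertI)
  have "{q :: bit poly. degree q \<le> d} \<subseteq> Poly ` {xs. set xs \<subseteq> UNIV \<and> length xs = Suc d}"
  proof
    fix q :: "bit poly" assume "q \<in> {q. degree q \<le> d}"
    then have "coeff q i = coeff (Poly (map (coeff q) [0..<Suc d])) i" for i
      by (auto simp: coeff_Poly_eq nth_default_def coeff_eq_0 simp del: upt_Suc)
    then have "q = Poly (map (coeff q) [0..<Suc d])" by (intro poly_eqI)
    then show "q \<in> Poly ` {xs. set xs \<subseteq> UNIV \<and> length xs = Suc d}" by (intro image_eqI) auto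
  qed
  then show ?thesis using finite_lists_length_eq[OF fin] finite_surj by blast
qed

lemma to_ac_hom: "comm_ring_hom_map to_ac"
  by unfold_locales auto

text \<open>For a nonzero polynomial \<open>p\<close> over the two-element field with root
  \<open>x\<close>, the powers of \<open>x\<close> are determined by the remainders of
  \<open>monom 1 n\<close> modulo \<open>p\<close>, of which there are finitely many.\<close>

lemma alg_closure_bit_torsion:
  fixes x :: "bit alg_closure"
  assumes "x \<noteq> 0"
  shows "\<exists>n>0. x ^ n = 1"
proof -
  obtain p :: "bit poly" where p: "p \<noteq> 0" "poly (map_poly to_ac p) x = 0"
    by (rule alg_closure_algebraic)
  interpret h: comm_ring_hom_map "map_poly to_ac :: bit poly \<Rightarrow> _"
    by (rule comm_ring_hom_map.map_poly_hom[OF to_ac_hom])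
  let ?r = "\<lambda>n. monom 1 n mod p"
  have pow: "poly (map_poly to_ac (?r n)) x = x ^ n" for n
  proof -
    have "monom 1 n = p * (monom 1 n div p) + ?r n" by simp
    then have "map_poly to_ac (monom 1 n) = map_poly to_ac p * map_poly to_ac (monom 1 n div p) + map_poly to_ac (?r n)"
      by (metis h.hom_add h.hom_mult)
    moreover have "map_poly to_ac (monom 1 n :: bit poly) = monom 1 n"
      by (simp add: map_poly_monom)
    ultimately have "poly (monom 1 n) x = poly (map_poly to_ac (?r n)) x" using p by simp
    then show ?thesis by (simp add: poly_monom)
  qed
  have "degree (?r n) \<le> degree p" for n
    using degree_mod_less[OF p(1), of "monom 1 n"] by auto
  then have "range ?r \<subseteq> {q. degree q \<le> degree p}" by auto
  then have "\<not> inj ?r"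
    using finite_subset[OF _ finite_bit_polys] finite_imageD[of ?r UNIV] infinite_UNIV_nat by auto
  then obtain i j where "?r i = ?r j" "i < j"
    unfolding inj_def by (metis nat_neq_iff)
  then have "x ^ i = x ^ j" using pow by metis
  also have "x ^ j = x ^ i * x ^ (j - i)" using \<open>i < j\<close> by (simp flip: power_add)
  finally have "x ^ (j - i) = 1" using assms by simp
  then show ?thesis using \<open>i < j\<close> by (intro exI[of _ "j - i"]) auto
qed

text \<open>Over a finite field, 1 plus the product of all \<open>[:-a, 1:]\<close> has no
  root.\<close>

lemma infinite_alg_closed: "infinite (UNIV :: 'a::alg_closed_field set)"
proof
  assume fin: "finite (UNIV :: 'a set)"
  let ?p = "1 + (\<Prod>a\<in>UNIV. [:-a, 1:]) :: 'a poly"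
  have deg: "degree (\<Prod>a\<in>UNIV. [:-a, 1:] :: 'a poly) = card (UNIV :: 'a set)"
    by (subst degree_prod_eq_sum_degree) auto
  have "card (UNIV :: 'a set) > 0" using fin by (simp add: card_gt_0_iff)
  then have "degree ?p = card (UNIV :: 'a set)"
    using deg by (subst degree_add_eq_right) auto
  then obtain x where "poly ?p x = 0"
    using alg_closed_imp_poly_has_root[of ?p] fin by (auto simp: card_gt_0_iff)
  moreover have "poly (\<Prod>a\<in>UNIV. [:-a, 1:]) x = (0::'a)"
    using fin by (auto simp: poly_prod)
  ultimately show False by simp
qed

lemma two_eq_0_ac: "(2 :: bit alg_closure) = 0"
  using to_ac_numeral[of "num.Bit0 num.One", where 'a = bit] by (simp only: bit_2_eq_0 to_ac_0)

lemma frobenius_hom: "comm_ring_hom_map (\<lambda>x :: bit alg_closure. x ^ (2 ^ n))"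
proof
  show "(x + y) ^ 2 ^ n = x ^ 2 ^ n + y ^ 2 ^ n" for x y :: "bit alg_closure"
  proof (induction n)
    case (Suc n)
    have "(x + y) ^ 2 ^ Suc n = ((x + y) ^ 2 ^ n)\<^sup>2"
      by (simp flip: power_mult add: mult.commute)
    also have "\<dots> = (x ^ 2 ^ n)\<^sup>2 + (y ^ 2 ^ n)\<^sup>2"
      using Suc by (simp add: power2_sum two_eq_0_ac)
    finally show ?case by (simp flip: power_mult add: mult.commute)
  qed simp
qed (auto simp: power_mult_distrib)

section \<open>Substitution of arcs into polynomials over power series\<close>

definition coeff_embed :: "nat \<Rightarrow> bit fps \<Rightarrow> bit alg_closure fps" where
  "coeff_embed e c = fps_map to_ac c oo fps_X ^ e"

lemma coeff_embed_nth: "coeff_embed e c $ n = (if e dvd n then to_ac (c $ (n div e)) else 0)"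
  by (simp add: coeff_embed_def fps_nth_compose_X_power)

lemma coeff_embed_hom: "e > 0 \<Longrightarrow> comm_ring_hom_map (coeff_embed e)"
proof -
  assume e: "e > 0"
  have X0: "(fps_X ^ e :: bit alg_closure fps) $ 0 = 0" using e by simp
  interpret comm_ring_hom_map "fps_map to_ac :: bit fps \<Rightarrow> _"
    by (rule comm_ring_hom_map.fps_map_hom[OF to_ac_hom])
  show ?thesis
    by unfold_locales
      (simp_all add: coeff_embed_def fps_compose_add_distrib fps_compose_mult_distrib[OF X0])
qed

lemma coeff_embed_eq_0_iff: "e > 0 \<Longrightarrow> coeff_embed e c = 0 \<longleftrightarrow> c = 0"
proof
  assume e: "e > 0" and "coeff_embed e c = 0"
  then have "to_ac (c $ n) = 0" for n
    using coeff_embed_nth[of e c "e * n"] by simp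
  then show "c = 0" by (intro fps_ext) simp
qed (simp add: coeff_embed_def fps_eq_iff fps_nth_compose_X_power)

text \<open>Restriction of a polynomial in \<open>x\<close> over the power series in
  \<open>t\<close> to the arc \<open>t = s ^ e\<close>, \<open>x = \<alpha>(s)\<close>.\<close>

definition arc_eval :: "nat \<Rightarrow> bit alg_closure fps \<Rightarrow> bit fps poly \<Rightarrow> bit alg_closure fps" where
  "arc_eval e \<alpha> p = poly (map_poly (coeff_embed e) p) \<alpha>"

lemma arc_eval_hom: "e > 0 \<Longrightarrow> comm_ring_hom_map (arc_eval e \<alpha>)"
  unfolding arc_eval_def
  by (intro comm_ring_hom_map_comp[OF comm_ring_hom_map.map_poly_hom[OF coeff_embed_hom]]
      comm_ring_hom_map_poly)

text \<open>Applying powers of the Frobenius to the coefficients of a root \<open>\<alpha>\<close> produces further roots.\<close>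

lemma arc_eval_neq_0:
  assumes e: "e > 0" and inf: "infinite (range (fps_nth \<alpha>))" and p: "p \<noteq> 0"
  shows "arc_eval e \<alpha> p \<noteq> 0"
proof
  assume zero: "arc_eval e \<alpha> p = 0"
  let ?P = "map_poly (coeff_embed e) p"
  let ?F = "\<lambda>n. fps_map (\<lambda>x :: bit alg_closure. x ^ (2 ^ n))"
  interpret c: comm_ring_hom_map "coeff_embed e" by (rule coeff_embed_hom[OF e])
  \<comment> \<open>The coefficients of \<open>?P\<close> come from the two-element field, so
    Frobenius powers fix them.\<close>
  have bit: "to_ac b ^ (2 ^ n) = to_ac b" for b :: bit and n :: nat
    by (cases b) (auto simp: zero_power)
  have "poly ?P (?F n \<alpha>) = 0" for n
  proof -
    interpret F: comm_ring_hom_map "?F n" by (rule comm_ring_hom_map.fps_map_hom[OF frobenius_hom])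
    have "?F n (poly ?P \<alpha>) = poly ?P (?F n \<alpha>)"
      by (rule F.poly_fixed_coeffs)
        (auto intro!: fps_ext simp: coeff_map_poly coeff_embed_nth bit zero_power)
    then show ?thesis using zero by (simp add: arc_eval_def)
  qed
  then have sub: "range (\<lambda>n. ?F n \<alpha>) \<subseteq> {x. poly ?P x = 0}" by auto
  have "?P \<noteq> 0"
    using p coeff_embed_eq_0_iff[OF e] by (auto simp: poly_eq_iff coeff_map_poly)
  then have fin: "finite (range (\<lambda>n. ?F n \<alpha>))"
    using finite_subset[OF sub] poly_roots_finite by blast
  \<comment> \<open>A coincidence for \<open>m < n\<close> would make all coefficients of
    \<open>\<alpha>\<close> roots of one nonzero polynomial \<open>?Q\<close>.\<close>
  have "inj (\<lambda>n. ?F n \<alpha>)"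
  proof (rule linorder_injI)
    fix m n :: nat assume mn: "m < n"
    show "?F m \<alpha> \<noteq> ?F n \<alpha>"
    proof
      assume eq: "?F m \<alpha> = ?F n \<alpha>"
      let ?Q = "monom 1 (2 ^ n) - monom 1 (2 ^ m) :: bit alg_closure poly"
      have "poly ?Q (\<alpha> $ k) = 0" for k
        using arg_cong[OF eq, of "\<lambda>f. f $ k"] by (simp add: poly_monom)
      then have "range (fps_nth \<alpha>) \<subseteq> {x. poly ?Q x = 0}" by auto
      moreover have "coeff ?Q (2 ^ n) = 1" using mn by simp
      then have "?Q \<noteq> 0" by (metis coeff_0 zero_neq_one)
      ultimately show False using inf poly_roots_finite finite_subset by blast
    qed
  qed
  then show False using fin finite_imageD infinite_UNIV_nat by blast
qed

lemma arc_eval_nth_0: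
  assumes "e > 0"
  shows "arc_eval e \<alpha> p $ 0 = poly (map_poly to_ac (map_poly (\<lambda>c. c $ 0) p)) (\<alpha> $ 0)"
  unfolding arc_eval_def
  by (rule comm_ring_hom_map.poly_fixed_coeffs[OF comm_ring_hom_map_fps_nth_0])
    (simp add: coeff_map_poly coeff_embed_nth comm_ring_hom_map.hom_zero[OF coeff_embed_hom[OF assms]])

section \<open>The family of valuations\<close>

locale nat_valuation =
  fixes u :: "'a::idom \<Rightarrow> nat"
  assumes u_mult: "a \<noteq> 0 \<Longrightarrow> b \<noteq> 0 \<Longrightarrow> u (a * b) = u a + u b"
    and u_add: "a \<noteq> 0 \<Longrightarrow> b \<noteq> 0 \<Longrightarrow> a + b \<noteq> 0 \<Longrightarrow> min (u a) (u b) \<le> u (a + b)"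
begin

definition fract_val :: "'a fract \<Rightarrow> int" where
  "fract_val x = (THE n. \<exists>a b. a \<noteq> 0 \<and> b \<noteq> 0 \<and> x = Fract a b \<and> n = int (u a) - int (u b))"

lemma fract_val_Fract:
  assumes "a \<noteq> 0" "b \<noteq> 0"
  shows "fract_val (Fract a b) = int (u a) - int (u b)"
  unfolding fract_val_def
proof (rule the_equality)
  fix n assume "\<exists>c d. c \<noteq> 0 \<and> d \<noteq> 0 \<and> Fract a b = Fract c d \<and> n = int (u c) - int (u d)"
  then obtain c d where cd: "c \<noteq> 0" "d \<noteq> 0" "Fract a b = Fract c d" "n = int (u c) - int (u d)"
    by auto
  then have "a * d = c * b" using assms by (simp add: eq_fract)
  then have "u a + u d = u c + u b" using assms cd by (metis u_mult)
  then show "n = int (u a) - int (u b)" using cd by linarith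
qed (use assms in blast)

lemma Fract_nonzeroE:
  assumes "(x :: 'a fract) \<noteq> 0"
  obtains a b where "a \<noteq> 0" "b \<noteq> 0" "x = Fract a b"
proof -
  obtain a b where ab: "b \<noteq> 0" "x = Fract a b" by (cases x) auto
  then have "a \<noteq> 0" using assms by (auto simp: fract_collapse)
  then show ?thesis using that ab by blast
qed

lemma fract_val_mult:
  assumes "x \<noteq> 0" "y \<noteq> 0"
  shows "fract_val (x * y) = fract_val x + fract_val y"
proof -
  obtain a b c d where "a \<noteq> 0" "b \<noteq> 0" "x = Fract a b" "c \<noteq> 0" "d \<noteq> 0" "y = Fract c d"
    using assms Fract_nonzeroE by metis
  then show ?thesis by (simp add: fract_val_Fract u_mult)
qed

lemma fract_val_add:
  assumes "x \<noteq> 0" "y \<noteq> 0" "x + y \<noteq> 0"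
  shows "min (fract_val x) (fract_val y) \<le> fract_val (x + y)"
proof -
  obtain a b c d where ab: "a \<noteq> 0" "b \<noteq> 0" "x = Fract a b" and cd: "c \<noteq> 0" "d \<noteq> 0" "y = Fract c d"
    using assms Fract_nonzeroE by metis
  have eq: "x + y = Fract (a * d + c * b) (b * d)" using ab cd by simp
  then have nz: "a * d + c * b \<noteq> 0" using assms(3) by (auto simp: fract_collapse)
  have "min (u a + u d) (u c + u b) \<le> u (a * d + c * b)"
    using u_add[of "a * d" "c * b"] ab cd nz by (simp add: u_mult)
  then show ?thesis
    unfolding eq using ab cd nz by (auto simp: fract_val_Fract u_mult)
qed

lemma u_one: "u 1 = 0"
  using u_mult[of 1 1] by simp

lemma fract_val_to_fract: "a \<noteq> 0 \<Longrightarrow> fract_val (to_fract a) = int (u a)"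
  using fract_val_Fract[of a 1] by (simp add: to_fract_def u_one)

lemma u_power: "a \<noteq> 0 \<Longrightarrow> u (a ^ n) = n * u a"
  by (induction n) (auto simp: u_one u_mult)

lemma u_unit: "a dvd 1 \<Longrightarrow> u a = 0"
  using u_mult u_one by (metis add_is_0 dvdE mult_zero_left mult_zero_right zero_neq_one)

end

lemma to_fract_hom: "comm_ring_hom_map (to_fract :: 'a::idom \<Rightarrow> 'a fract)"
  by unfold_locales auto

lemma nat_valuation_subdegree:
  assumes "comm_ring_hom_map \<phi>" "\<And>p. p \<noteq> 0 \<Longrightarrow> \<phi> p \<noteq> (0 :: 'b::idom fps)"
  shows "nat_valuation (\<lambda>p :: 'a::idom. subdegree (\<phi> p))"
proof
  interpret comm_ring_hom_map \<phi> by (rule assms)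
  show "subdegree (\<phi> (a * b)) = subdegree (\<phi> a) + subdegree (\<phi> b)" if "a \<noteq> 0" "b \<noteq> 0" for a b
    using that assms(2) by simp
  show "min (subdegree (\<phi> a)) (subdegree (\<phi> b)) \<le> subdegree (\<phi> (a + b))" if "a + b \<noteq> 0" for a b
    using subdegree_add_ge'[of "\<phi> a" "\<phi> b"] assms(2)[OF that] by simp
qed

lemma nat_valuation_multiplicity:
  fixes p :: "'a::{factorial_semiring, idom}"
  assumes "prime_elem p"
  shows "nat_valuation (multiplicity p)"
proof
  show "multiplicity p (a * b) = multiplicity p a + multiplicity p b" if "a \<noteq> 0" "b \<noteq> 0" for a b
    using that assms by (rule prime_elem_multiplicity_mult_distrib[rotated])
  show "min (multiplicity p a) (multiplicity p b) \<le> multiplicity p (a + b)" if "a + b \<noteq> 0" for a b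
  proof (rule multiplicity_geI)
    show "p ^ min (multiplicity p a) (multiplicity p b) dvd a + b"
      by (intro dvd_add) (auto intro: dvd_trans[OF le_imp_power_dvd multiplicity_dvd])
  qed (use that assms in auto)
qed

section \<open>The two arcs and the set of places\<close>

definition residues :: "nat \<Rightarrow> bit alg_closure" where
  "residues = (SOME c. inj c \<and> (\<forall>n. c n \<noteq> 0))"

text \<open>Distinct coefficients make the arcs transcendental through
  \<open>arc_eval_neq_0\<close>; \<open>residues 0 \<noteq> 0\<close> fixes the values computed in
  \<open>nval_linear\<close>.\<close>

lemma residues: "inj residues" "residues n \<noteq> 0"
proof -
  have "infinite (- {0 :: bit alg_closure})"
    using infinite_alg_closed by (simp add: Compl_eq_Diff_UNIV)
  then obtain c :: "nat \<Rightarrow> bit alg_closure" where "inj c" "range c \<subseteq> - {0}"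
    using infinite_countable_subset by blast
  then have "\<exists>c :: nat \<Rightarrow> bit alg_closure. inj c \<and> (\<forall>n. c n \<noteq> 0)" by blast
  from someI_ex[OF this] show "inj residues" "residues n \<noteq> 0"
    by (auto simp: residues_def)
qed

text \<open>Together with the substitutions \<open>t = s^2\<close> and \<open>t = s\<close>, these are the values of \<open>x\<close> on the two arcs.\<close>

definition arc1 :: "bit alg_closure fps" where "arc1 = fps_X ^ 3 * Abs_fps residues"
definition arc2 :: "bit alg_closure fps" where "arc2 = 1 + fps_X * Abs_fps residues"

lemma infinite_range_residues: "infinite (range residues)"
  using residues finite_imageD infinite_UNIV_nat by blast

lemma arc_coeffs_infinite: "infinite (range (fps_nth arc1))" "infinite (range (fps_nth arc2))"
proof -
  have "arc1 $ (n + 3) = residues n" for n by (simp add: arc1_def fps_X_power_mult_nth)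
  then have "range residues \<subseteq> range (fps_nth arc1)" by (metis image_subsetI rangeI)
  then show "infinite (range (fps_nth arc1))" using infinite_range_residues finite_subset by blast
  have "arc2 $ (Suc n) = residues n" for n by (simp add: arc2_def)
  then have "range residues \<subseteq> range (fps_nth arc2)" by (metis image_subsetI rangeI)
  then show "infinite (range (fps_nth arc2))" using infinite_range_residues finite_subset by blast
qed

datatype place = Arc1 | Arc2 | Prime "bit fps poly"

fun nval :: "place \<Rightarrow> bit fps poly \<Rightarrow> nat" where
  "nval Arc1 r = subdegree (arc_eval 2 arc1 r)"
| "nval Arc2 r = subdegree (arc_eval 1 arc2 r)"
| "nval (Prime f) r = multiplicity f r"

text \<open>The negative of the contribution \<open>nval Arc1 f - 2 * nval Arc2 f\<close> of the two
  arcs to the degree of \<open>f\<close>; it vanishes on \<open>tpoly\<close>.\<close>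

definition arc_weight :: "bit fps poly \<Rightarrow> int" where
  "arc_weight f = 2 * int (nval Arc2 f) - int (nval Arc1 f)"

fun weight :: "place \<Rightarrow> int" where
  "weight Arc1 = 1"
| "weight Arc2 = -2"
| "weight (Prime f) = arc_weight f"

definition tpoly :: "bit fps poly" where "tpoly = [:fps_X:]"

text \<open>Primes of weight 0 are principal up to powers of \<open>tpoly\<close> and are inverted.\<close>

definition places :: "place set" where
  "places = {Arc1, Arc2} \<union> Prime ` {f. prime f \<and> \<not> f dvd tpoly \<and> arc_weight f \<noteq> 0}"

abbreviation val :: "place \<Rightarrow> bit fps poly fract \<Rightarrow> int" where
  "val i \<equiv> nat_valuation.fract_val (nval i)"

lemma arcs_in_places [simp]: "Arc1 \<in> places" "Arc2 \<in> places"
  by (auto simp: places_def)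

lemma Prime_in_places [simp]: "Prime f \<in> places \<longleftrightarrow> prime f \<and> \<not> f dvd tpoly \<and> arc_weight f \<noteq> 0"
  by (auto simp: places_def)

lemma arc_eval_homs: "comm_ring_hom_map (arc_eval 2 arc1)" "comm_ring_hom_map (arc_eval 1 arc2)"
  by (simp_all add: arc_eval_hom)

lemma arc_eval_nonzero: "p \<noteq> 0 \<Longrightarrow> arc_eval 2 arc1 p \<noteq> 0" "p \<noteq> 0 \<Longrightarrow> arc_eval 1 arc2 p \<noteq> 0"
  by (rule arc_eval_neq_0[OF _ arc_coeffs_infinite(1)], simp, assumption)
    (rule arc_eval_neq_0[OF _ arc_coeffs_infinite(2)], simp, assumption)

lemma arc_valuations: "nat_valuation (nval Arc1)" "nat_valuation (nval Arc2)"
proof -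
  have eq: "nval Arc1 = (\<lambda>p. subdegree (arc_eval 2 arc1 p))" "nval Arc2 = (\<lambda>p. subdegree (arc_eval 1 arc2 p))"
    by auto
  show "nat_valuation (nval Arc1)" "nat_valuation (nval Arc2)"
    unfolding eq
    by (rule nat_valuation_subdegree[OF arc_eval_homs(1) arc_eval_nonzero(1)], assumption)
      (rule nat_valuation_subdegree[OF arc_eval_homs(2) arc_eval_nonzero(2)], assumption)
qed

lemma nval_Prime: "nval (Prime f) = multiplicity f"
  by auto

lemma nval_valuation: "i \<in> places \<Longrightarrow> nat_valuation (nval i)"
proof (cases i)
  case (Prime f)
  assume "i \<in> places"
  then show ?thesis unfolding Prime nval_Prime by (intro nat_valuation_multiplicity) auto
qed (simp_all only: arc_valuations)

lemma val_to_fract: "i \<in> places \<Longrightarrow> r \<noteq> 0 \<Longrightarrow> val i (to_fract r) = int (nval i r)"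
  by (rule nat_valuation.fract_val_to_fract[OF nval_valuation])

lemma val_Fract: "i \<in> places \<Longrightarrow> a \<noteq> 0 \<Longrightarrow> b \<noteq> 0 \<Longrightarrow> val i (Fract a b) = int (nval i a) - int (nval i b)"
  by (rule nat_valuation.fract_val_Fract[OF nval_valuation])

lemma nonzero_places:
  assumes "a \<noteq> 0" "b \<noteq> 0" "i \<in> places" "val i (Fract a b) \<noteq> 0"
  shows "i \<in> {Arc1, Arc2} \<union> Prime ` {f \<in> prime_factors a \<union> prime_factors b. \<not> f dvd tpoly \<and> arc_weight f \<noteq> 0}"
proof (cases i)
  case (Prime f)
  then have f: "prime f" "\<not> f dvd tpoly" "arc_weight f \<noteq> 0" using assms by auto
  have "multiplicity f a \<noteq> 0 \<or> multiplicity f b \<noteq> 0"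
    using assms Prime by (auto simp: val_Fract)
  then have "f dvd a \<or> f dvd b"
    using not_dvd_imp_multiplicity_0[of f a] not_dvd_imp_multiplicity_0[of f b] by argo
  then show ?thesis using f Prime assms by (auto simp: prime_factors_dvd)
qed auto

interpretation P: valuation_family places val
proof
  fix x :: "bit fps poly fract" assume "x \<noteq> 0"
  then obtain a b where ab: "a \<noteq> 0" "b \<noteq> 0" "x = Fract a b"
    by (rule nat_valuation.Fract_nonzeroE[OF arc_valuations(1)])
  show "finite {i \<in> places. val i x \<noteq> 0}"
    by (rule finite_subset[of _ "{Arc1, Arc2} \<union> Prime ` {f \<in> prime_factors a \<union> prime_factors b. \<not> f dvd tpoly \<and> arc_weight f \<noteq> 0}"])
      (use nonzero_places[OF ab(1,2)] ab(3) in auto)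
qed (auto intro: nat_valuation.fract_val_mult[OF nval_valuation] nat_valuation.fract_val_add[OF nval_valuation])

section \<open>Values of \<open>t\<close>, \<open>x\<close>, \<open>x + 1\<close> and residues on
  the arcs\<close>

lemma tpoly_nz [simp]: "tpoly \<noteq> 0"
  by (simp add: tpoly_def)

lemma arc_eval_const: "e > 0 \<Longrightarrow> arc_eval e \<alpha> [:c:] = coeff_embed e c"
  by (cases "c = 0") (auto simp: arc_eval_def map_poly_pCons comm_ring_hom_map.hom_zero[OF coeff_embed_hom])

lemma coeff_embed_X: "e > 0 \<Longrightarrow> coeff_embed e fps_X = fps_X ^ e"
proof -
  assume "e > 0"
  have "fps_map to_ac (fps_X :: bit fps) = fps_X" by (rule fps_ext) (auto simp: fps_X_def)
  then show ?thesis using \<open>e > 0\<close> by (simp add: coeff_embed_def fps_X_fps_compose_startby0)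
qed

lemma nval_tpoly: "nval Arc1 tpoly = 2" "nval Arc2 tpoly = 1"
  by (simp_all add: tpoly_def arc_eval_const coeff_embed_X)

lemma arc_eval_linear: "e > 0 \<Longrightarrow> arc_eval e \<alpha> [:c, 1:] = coeff_embed e c + \<alpha>"
  using comm_ring_hom_map.hom_one[OF coeff_embed_hom, of e] comm_ring_hom_map.hom_zero[OF coeff_embed_hom, of e]
  by (simp add: arc_eval_def map_poly_pCons)

lemma nval_linear:
  "nval Arc1 [:0, 1:] = 3" "nval Arc2 [:0, 1:] = 0" "nval Arc1 [:1, 1:] = 0" "nval Arc2 [:1, 1:] = 1"
proof -
  have sub: "subdegree (Abs_fps residues) = 0" "Abs_fps residues \<noteq> 0"
    using residues by (auto simp: fps_eq_iff)
  have hom: "coeff_embed 2 0 = 0" "coeff_embed 1 0 = 0" "coeff_embed 2 1 = 1" "coeff_embed 1 1 = 1"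
    using comm_ring_hom_map.hom_one[OF coeff_embed_hom] comm_ring_hom_map.hom_zero[OF coeff_embed_hom] by auto
  show "nval Arc1 [:0, 1:] = 3"
    using sub hom by (simp add: arc_eval_linear arc1_def fps_subdegree_mult_fps_X_power)
  show "nval Arc2 [:0, 1:] = 0"
    using hom by (simp add: arc_eval_linear arc2_def subdegree_eq_0)
  show "nval Arc1 [:1, 1:] = 0"
    using hom by (simp add: arc_eval_linear arc1_def subdegree_eq_0)
  \<comment> \<open>Characteristic two cancels the constant term of \<open>1 + arc2\<close>.\<close>
  have "(2 :: bit alg_closure fps) = 0"
    by (rule fps_ext) (simp add: numeral_fps_const two_eq_0_ac)
  moreover have "coeff_embed 1 1 + arc2 = 2 + fps_X * Abs_fps residues"
    using hom by (simp add: arc2_def)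
  ultimately have "coeff_embed 1 1 + arc2 = fps_X * Abs_fps residues" by simp
  then have "arc_eval 1 arc2 [:1, 1:] = fps_X * Abs_fps residues"
    by (simp only: arc_eval_linear zero_less_one)
  then show "nval Arc2 [:1, 1:] = 1"
    using sub by (simp add: fps_subdegree_mult_fps_X)
qed

text \<open>The ratio of the lowest nonzero coefficients is a root of unity by
  \<open>alg_closure_bit_torsion\<close>, so suitable powers have the same lowest term.\<close>

lemma fps_torsion:
  fixes a b :: "bit alg_closure fps"
  assumes "a \<noteq> 0" "b \<noteq> 0" "subdegree a = subdegree b"
  shows "\<exists>n>0. a ^ n = b ^ n \<or> n * subdegree b < subdegree (a ^ n - b ^ n)"
proof -
  define k where "k = subdegree b"
  define a' b' where "a' = fps_shift k a" and "b' = fps_shift k b"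
  have dec: "a = a' * fps_X ^ k" "b = b' * fps_X ^ k"
    using subdegree_decompose assms unfolding a'_def b'_def k_def by metis+
  have nz: "a' $ 0 \<noteq> 0" "b' $ 0 \<noteq> 0"
    using assms nth_subdegree_nonzero[of a] nth_subdegree_nonzero[of b] by (auto simp: a'_def b'_def k_def)
  then obtain n where n: "n > 0" "(a' $ 0 / b' $ 0) ^ n = 1"
    using alg_closure_bit_torsion[of "a' $ 0 / b' $ 0"] by auto
  have "(a' ^ n - b' ^ n) $ 0 = 0"
    using n nz by (simp add: fps_power_zeroth power_divide)
  moreover have eq: "a ^ n - b ^ n = (a' ^ n - b' ^ n) * fps_X ^ (k * n)"
    by (subst dec, subst dec) (simp add: power_mult_distrib power_mult left_diff_distrib)
  moreover have "n * k < subdegree (a ^ n - b ^ n)" if "a ^ n \<noteq> b ^ n"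
  proof -
    have nz': "a' ^ n - b' ^ n \<noteq> 0" using that eq by auto
    then have "subdegree (a' ^ n - b' ^ n) > 0"
      using \<open>(a' ^ n - b' ^ n) $ 0 = 0\<close> by (intro gr0I) (simp add: subdegree_eq_0_iff)
    then show ?thesis
      unfolding eq using nz' by (simp add: fps_subdegree_mult_fps_X_power mult.commute)
  qed
  ultimately show ?thesis using n unfolding k_def by blast
qed

text \<open>The residue field of an arc is algebraic over the two-element field, so nonzero residues
  are roots of unity; \<open>fps_torsion\<close> is applied to numerator and denominator.\<close>

lemma arc_torsion:
  assumes i: "i \<in> {Arc1, Arc2}" and x: "x \<noteq> 0" "val i x = 0"
  shows "\<exists>n>0. P.ge i 1 (x ^ n - 1)"
proof -
  obtain \<phi> where \<phi>: "comm_ring_hom_map \<phi>" "\<And>p. p \<noteq> 0 \<Longrightarrow> \<phi> p \<noteq> 0"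
    "\<And>p. nval i p = subdegree (\<phi> p :: bit alg_closure fps)"
    using i arc_eval_homs arc_eval_nonzero nval.simps by fastforce
  interpret h: comm_ring_hom_map \<phi> by (rule \<phi>)
  have iI: "i \<in> places" using i by auto
  obtain a b where ab: "a \<noteq> 0" "b \<noteq> 0" "x = Fract a b"
    using x(1) by (rule nat_valuation.Fract_nonzeroE[OF arc_valuations(1)])
  have "subdegree (\<phi> a) = subdegree (\<phi> b)" using x ab iI by (simp add: val_Fract \<phi>)
  then obtain n where n: "n > 0" "\<phi> a ^ n = \<phi> b ^ n \<or> n * subdegree (\<phi> b) < subdegree (\<phi> a ^ n - \<phi> b ^ n)"
    using fps_torsion \<phi> ab by metis
  have \<phi>_diff: "\<phi> (a ^ n - b ^ n) = \<phi> a ^ n - \<phi> b ^ n"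
    using h.hom_add[of "a ^ n" "- (b ^ n)"] by simp
  have xn: "x ^ n - 1 = to_fract (a ^ n - b ^ n) / to_fract (b ^ n)"
    using ab
    by (simp add: Fract_conv_to_fract power_divide diff_divide_distrib
        comm_ring_hom_map.hom_power[OF to_fract_hom])
  have "P.ge i 1 (x ^ n - 1)"
  proof (cases "a ^ n = b ^ n")
    case True
    then show ?thesis unfolding xn by simp
  next
    case False
    then have "\<phi> a ^ n \<noteq> \<phi> b ^ n" using \<phi>(2)[of "a ^ n - b ^ n"] \<phi>_diff by auto
    then have "n * subdegree (\<phi> b) < nval i (a ^ n - b ^ n)" using n by (simp add: \<phi> \<phi>_diff)
    moreover have "nval i (b ^ n) = n * subdegree (\<phi> b)"
      using nat_valuation.u_power[OF nval_valuation[OF iI] ab(2)] by (simp add: \<phi>)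
    moreover have "val i (x ^ n - 1) = int (nval i (a ^ n - b ^ n)) - int (nval i (b ^ n))"
    proof -
      have "a ^ n - b ^ n \<noteq> 0" "b ^ n \<noteq> 0" using False ab by auto
      then show ?thesis
        unfolding xn using iI P.v_divide[of i "to_fract (a ^ n - b ^ n)" "to_fract (b ^ n)"]
        by (simp only: val_to_fract to_fract_eq_0_iff not_False_eq_True)
    qed
    ultimately have "1 \<le> val i (x ^ n - 1)" by linarith
    then show ?thesis by (simp add: P.ge_def)
  qed
  then show ?thesis using n by blast
qed

section \<open>Inverses modulo the places and separation\<close>

interpretation to_fract: comm_ring_hom_map "to_fract :: bit fps poly \<Rightarrow> bit fps poly fract"
  by (rule to_fract_hom)

lemma to_fract_ge: "i \<in> places \<Longrightarrow> P.ge i 0 (to_fract r)"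
  by (cases "r = 0") (auto simp: P.ge_def val_to_fract)

lemma to_fract_in_A: "to_fract r \<in> P.ring_at places"
  by (auto simp: P.ring_at_def to_fract_ge)

lemma val_Prime_tpoly: "Prime f \<in> places \<Longrightarrow> val (Prime f) (to_fract tpoly) = 0"
  by (simp add: val_to_fract not_dvd_imp_multiplicity_0)

lemma val_tpoly: "val Arc1 (to_fract tpoly) = 2" "val Arc2 (to_fract tpoly) = 1"
  by (simp_all add: val_to_fract nval_tpoly del: nval.simps)

text \<open>The factor \<open>z\<close> cancels the values of \<open>r\<close> on both arcs; its
  only denominator is a power of \<open>t\<close>, which is a unit at all \<open>Prime\<close>
  places.\<close>

lemma multiple_trivial_on_arcs:
  assumes r: "r \<noteq> 0"
  shows "\<exists>g\<in>P.ring_at places. g \<noteq> 0 \<and> val Arc1 g = 0 \<and> val Arc2 g = 0 \<and>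
    (\<forall>i\<in>places - {Arc1, Arc2}. int (nval i r) \<le> val i g)"
proof -
  define a b where "a = nval Arc1 r" and "b = nval Arc2 r"
  define x y t where "x = to_fract [:0, 1 :: bit fps:]" and "y = to_fract [:1, 1 :: bit fps:]"
    and "t = to_fract tpoly"
  \<comment> \<open>As \<open>x\<close>, \<open>y\<close>, \<open>t\<close> have the values
    \<open>(3, 0)\<close>, \<open>(0, 1)\<close>, \<open>(2, 1)\<close> on the arcs, these exponents
    give \<open>z\<close> the values \<open>(- a, - b)\<close>.\<close>
  define z where "z = x ^ (a + 2 * b) * y ^ (2 * a + 2 * b) / t ^ (2 * a + 3 * b)"
  have nz: "x \<noteq> 0" "y \<noteq> 0" "t \<noteq> 0" by (simp_all add: x_def y_def t_def)
  have vz: "val i z = int (a + 2 * b) * val i x + int (2 * a + 2 * b) * val i y - int (2 * a + 3 * b) * val i t"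
    if "i \<in> places" for i
    using that nz by (simp add: z_def P.v_divide P.v_mult P.v_power del: of_nat_add of_nat_mult)
  have arc_vals: "val Arc1 x = 3" "val Arc2 x = 0" "val Arc1 y = 0" "val Arc2 y = 1"
    "val Arc1 t = 2" "val Arc2 t = 1"
    using nval_linear val_tpoly by (simp_all add: x_def y_def t_def val_to_fract del: nval.simps)
  have z0: "z \<noteq> 0" using nz by (simp add: z_def)
  have "val Arc1 (to_fract r * z) = int a + val Arc1 z" "val Arc2 (to_fract r * z) = int b + val Arc2 z"
    using r z0 by (simp_all add: P.v_mult val_to_fract a_def b_def del: nval.simps)
  then have arcs: "val Arc1 (to_fract r * z) = 0" "val Arc2 (to_fract r * z) = 0"
    by (simp_all add: vz arc_vals)
  have "0 \<le> val i z" if i: "i \<in> places - {Arc1, Arc2}" for i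
  proof -
    obtain f where "i = Prime f" using i by (cases i) auto
    then have "val i t = 0" using i val_Prime_tpoly unfolding t_def by simp
    moreover have "P.ge i 0 x" "P.ge i 0 y"
      using i by (auto simp: x_def y_def intro: to_fract_ge)
    then have "0 \<le> val i x" "0 \<le> val i y"
      using nz by (auto simp: P.ge_def)
    ultimately show ?thesis using i by (simp add: vz)
  qed
  then have ge: "int (nval i r) \<le> val i (to_fract r * z)" if "i \<in> places - {Arc1, Arc2}" for i
    using that r z0 by (simp add: P.v_mult val_to_fract)
  have "P.ge i 0 (to_fract r * z)" if i: "i \<in> places" for i
  proof (cases "i \<in> {Arc1, Arc2}")
    case False
    then have "int (nval i r) \<le> val i (to_fract r * z)" using ge i by blast
    then have "0 \<le> val i (to_fract r * z)" by linarith
    then show ?thesis unfolding P.ge_def by blast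
  next
    case True
    then have "val i (to_fract r * z) = 0" using arcs by blast
    then show ?thesis unfolding P.ge_def by simp
  qed
  then have "to_fract r * z \<in> P.ring_at places" by (auto simp: P.ring_at_def)
  then show ?thesis using arcs ge r z0 by (intro bexI[of _ "to_fract r * z"]) auto
qed

text \<open>A nonzero power series is a unit times a power of its variable.\<close>

lemma const_dvd_tpoly_power:
  assumes "(c :: bit fps) \<noteq> 0"
  shows "\<exists>k d. [:c:] * d = tpoly ^ k"
proof -
  define k where "k = subdegree c"
  define e where "e = fps_shift k c"
  have c: "c = e * fps_X ^ k" using subdegree_decompose[of c] by (simp add: e_def k_def)
  have "e $ 0 \<noteq> 0" using assms nth_subdegree_nonzero[of c] by (simp add: e_def k_def)
  then have "e * inverse e = 1" by (metis inverse_mult_eq_1 mult.commute)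
  then have "c * inverse e = fps_X ^ k" unfolding c by (simp add: algebra_simps)
  then have "[:c:] * [:inverse e:] = [:fps_X ^ k:]" by (simp add: mult.commute)
  moreover have "tpoly ^ k = [:fps_X ^ k:]" by (induction k) (auto simp: tpoly_def one_pCons)
  ultimately show ?thesis by (intro exI[of _ k] exI[of _ "[:inverse e:]"]) simp
qed

text \<open>Inverting \<open>t\<close> turns the coefficients into a field. A nonzero
  \<open>g\<close> of least degree in the ideal generated by \<open>p\<close> and \<open>f\<close>
  divides nonzero constant multiples of both by pseudo-division; as \<open>f\<close> does not divide
  \<open>g\<close>, \<open>g\<close> divides a nonzero constant and hence a power of
  \<open>t\<close>.\<close>

lemma bezout_tpoly_power:
  assumes f: "prime f" "\<not> f dvd tpoly" and p: "\<not> f dvd p"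
  shows "\<exists>a b k. p * a + f * b = tpoly ^ k"
proof -
  have f0: "f \<noteq> 0" using f by auto
  define J where "J = {g. g \<noteq> 0 \<and> (\<exists>a b. g = p * a + f * b)}"
  have "f = p * 0 + f * 1" by simp
  then have "f \<in> J" using f0 unfolding J_def by blast
  define g where "g = arg_min degree (\<lambda>g. g \<in> J)"
  have g: "g \<in> J" unfolding g_def by (rule arg_min_natI) (rule \<open>f \<in> J\<close>)
  have g_min: "degree g \<le> degree h" if "h \<in> J" for h
    unfolding g_def by (rule arg_min_nat_le) (rule that)
  obtain a b where ab: "g = p * a + f * b" and g0: "g \<noteq> 0" using g by (auto simp: J_def)
  have const_mult: "\<exists>c d. c \<noteq> 0 \<and> smult c q = g * d"
    if q: "\<exists>a b. q = p * a + f * b" for q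
  proof -
    obtain d r where dr: "pseudo_divmod q g = (d, r)" by fastforce
    define c where "c = lead_coeff g ^ (Suc (degree q) - degree g)"
    have eq: "smult c q = g * d + r" and r: "r = 0 \<or> degree r < degree g"
      using pseudo_divmod[OF g0 dr] by (simp_all add: c_def)
    have "r = 0"
    proof (rule ccontr)
      assume r0: "r \<noteq> 0"
      obtain a' b' where q': "q = p * a' + f * b'" using q by auto
      have "r = p * (smult c a' - a * d) + f * (smult c b' - b * d)"
        using eq unfolding q' ab by (simp add: algebra_simps smult_add_right)
      then have "r \<in> J" using r0 by (auto simp: J_def)
      then show False using g_min[of r] r r0 by auto
    qed
    moreover have "c \<noteq> 0" using g0 by (simp add: c_def)
    ultimately show ?thesis using eq by auto
  qed
  have not_dvd_const: "\<not> f dvd [:c:]" if c: "c \<noteq> 0" for c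
  proof
    assume "f dvd [:c:]"
    moreover obtain k d where "[:c:] * d = tpoly ^ k" using const_dvd_tpoly_power[OF c] by blast
    ultimately have "f dvd tpoly ^ k" by (metis dvd_mult2)
    then show False using f prime_dvd_power by blast
  qed
  obtain c d where cd: "c \<noteq> 0" "smult c f = g * d"
    using const_mult[of f] by (metis add_0 mult.right_neutral mult_zero_right)
  obtain c' d' where cd': "c' \<noteq> 0" "smult c' p = g * d'"
    using const_mult[of p] by (metis add_0_right mult.right_neutral mult_zero_right)
  have "\<not> f dvd g"
  proof
    assume "f dvd g"
    then have "f dvd [:c':] * p" using cd' by simp
    then show False using not_dvd_const[OF cd'(1)] p f prime_dvd_multD by blast
  qed
  moreover have "f dvd g * d" using cd(2) by (metis dvd_refl dvd_smult)
  ultimately have "f dvd d" using f prime_dvd_multD by blast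
  then obtain e where e: "d = f * e" by auto
  have "[:c:] * f = (g * e) * f" using cd(2) e by (simp add: algebra_simps)
  then have ge: "g * e = [:c:]" using f0 by (metis mult_right_cancel)
  obtain k e' where "[:c:] * e' = tpoly ^ k" using const_dvd_tpoly_power[OF cd(1)] by blast
  moreover have "p * (a * e * e') + f * (b * e * e') = g * e * e'"
    unfolding ab by (simp add: algebra_simps)
  ultimately show ?thesis using ge by metis
qed

lemma coprime_fraction:
  assumes "(x :: bit fps poly fract) \<noteq> 0"
  obtains p q where "p \<noteq> 0" "q \<noteq> 0" "coprime p q" "x = Fract p q"
proof -
  let ?p = "fst (quot_of_fract x)" and ?q = "snd (quot_of_fract x)"
  have x: "x = Fract ?p ?q" by simp
  moreover have q: "?q \<noteq> 0" by (rule snd_quot_of_fract_nonzero)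
  moreover have "?p \<noteq> 0"
  proof
    assume "?p = 0"
    then have "x = Fract 0 ?q" using x by metis
    then show False using assms by (simp add: fract_collapse)
  qed
  moreover have "coprime ?p ?q" by (rule coprime_quot_of_fract)
  ultimately show ?thesis using that by metis
qed

text \<open>Some positive power of \<open>b\<close> is 1 at the arc, so the preceding power inverts
  \<open>b\<close>.\<close>

lemma residue_inverse_arc:
  assumes i: "i \<in> {Arc1, Arc2}" and b: "b \<in> P.ring_at places" "b \<noteq> 0" "val i b = 0"
  shows "\<exists>b'\<in>P.ring_at places. P.ge i 1 (b * b' - 1)"
proof -
  obtain n where n: "n > 0" "P.ge i 1 (b ^ n - 1)" using arc_torsion[OF i b(2,3)] by auto
  then have "P.ge i 1 (b * b ^ (n - 1) - 1)" by (cases n) auto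
  moreover have "b ^ (n - 1) \<in> P.ring_at places" using b by (intro P.ring_at_power) auto
  ultimately show ?thesis by blast
qed

text \<open>For \<open>b = p / q\<close> in lowest terms, \<open>bezout_tpoly_power\<close> gives
  the inverse \<open>q * p' / t ^ m\<close> modulo \<open>f\<close>. It remains to remove its poles
  on the arcs.\<close>

lemma residue_inverse_Prime:
  assumes i: "Prime f \<in> places" and b: "b \<in> P.ring_at places" "b \<noteq> 0" "val (Prime f) b = 0"
  shows "\<exists>b'\<in>P.ring_at places. P.ge (Prime f) 1 (b * b' - 1)"
proof -
  have f: "prime f" "\<not> f dvd tpoly" using i by auto
  then have f0: "f \<noteq> 0" by auto
  let ?i = "Prime f"
  obtain p q where pq: "p \<noteq> 0" "q \<noteq> 0" "coprime p q" "b = Fract p q"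
    using coprime_fraction[OF b(2)] by metis
  have mult_eq: "multiplicity f p = multiplicity f q"
    using b(3) i pq by (simp add: val_Fract)
  have "\<not> f dvd p"
  proof
    assume *: "f dvd p"
    then have "multiplicity f p \<noteq> 0" using pq f by (simp add: prime_elem_multiplicity_eq_zero_iff)
    then have "f dvd q" using mult_eq not_dvd_imp_multiplicity_0[of f q] by argo
    then show False using * pq(3) f by (meson coprime_common_divisor not_prime_unit)
  qed
  then obtain p' s m where ps: "p * p' + f * s = tpoly ^ m" using bezout_tpoly_power[OF f] by blast
  obtain g where g: "g \<in> P.ring_at places" "g \<noteq> 0" "val Arc1 g = 0" "val Arc2 g = 0"
    "\<forall>i\<in>places - {Arc1, Arc2}. int (nval i f) \<le> val i g" using multiple_trivial_on_arcs[OF f0] by auto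
  have g_ge: "P.ge j 0 g" if "j \<in> places" for j
    using g(1) that by (auto simp: P.ring_at_def)
  have "multiplicity f f = 1" using f f0 by (intro multiplicity_self) auto
  moreover have "int (nval ?i f) \<le> val ?i g" using i g(5) by blast
  ultimately have "P.ge ?i 1 (to_fract f)" "P.ge ?i 1 g"
    using i f0 by (simp_all add: P.ge_def val_to_fract)
  note g_f = this(2)
  obtain n1 where n1: "n1 > 0" "P.ge Arc1 1 (g ^ n1 - 1)" using arc_torsion[of Arc1 g] g by auto
  obtain n2 where n2: "n2 > 0" "P.ge Arc2 1 (g ^ n2 - 1)" using arc_torsion[of Arc2 g] g by auto
  \<comment> \<open>A common multiple of the torsion exponents of \<open>g\<close> on the two
    arcs.\<close>
  define N where "N = n1 * n2"
  have g_pow: "P.ge j 0 (g ^ n)" if "j \<in> places" for j n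
    using P.ge_power[OF that g_ge[OF that], of n] by simp
  have N: "P.ge Arc1 1 (g ^ N - 1)" "P.ge Arc2 1 (g ^ N - 1)"
    using P.ge_power_minus_one[OF _ g_pow n1(2), of n2] P.ge_power_minus_one[OF _ g_pow n2(2), of n1]
    by (simp_all add: N_def power_mult mult.commute flip: power_mult)
  \<comment> \<open>\<open>y\<close> vanishes on both arcs and is 1 modulo \<open>f\<close>: its powers clear the denominator \<open>tpoly ^ m\<close> of the
    inverse of \<open>b\<close> modulo \<open>f\<close>.\<close>
  define y where "y = 1 - g ^ N"
  have y_arc: "P.ge Arc1 1 y" "P.ge Arc2 1 y"
    using N P.ge_minus[of Arc1 1 "g ^ N - 1"] P.ge_minus[of Arc2 1 "g ^ N - 1"] by (simp_all add: y_def)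
  have y_ge: "P.ge j 0 y" if "j \<in> places" for j
    unfolding y_def using g_pow that by (intro P.ge_diff) auto
  have "N > 0" using n1 n2 by (simp add: N_def)
  then have "g ^ N = g ^ (N - 1) * g" by (cases N) auto
  then have "P.ge ?i 1 (g ^ N)" using P.ge_mult_left[OF i g_pow[OF i] g_f, of "N - 1"] by simp
  then have y_f: "P.ge ?i 1 (y - 1)" using P.ge_minus[OF i, of 1 "g ^ N"] by (simp add: y_def)
  define t where "t = to_fract tpoly"
  have t0: "t \<noteq> 0" by (simp add: t_def)
  \<comment> \<open>The exponent \<open>2 * m\<close> is at least the order of \<open>t ^ m\<close>
    on both arcs, which is \<open>2 * m\<close> at \<open>Arc1\<close> and \<open>m\<close> at
    \<open>Arc2\<close>.\<close>
  define c where "c = (to_fract (q * p') * y ^ (2 * m)) / t ^ m"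
  have "P.ge j 0 c" if j: "j \<in> places" for j
  proof -
    have div: "P.ge j (n - int m * val j t) c" if "P.ge j n (y ^ (2 * m))" for n
      unfolding c_def
      using P.ge_divide[OF j P.ge_mult_left[OF j to_fract_ge[OF j, of "q * p'"] that], of "t ^ m"] t0 j
      by (simp add: P.v_power)
    show ?thesis
    proof (cases j)
      case Arc1
      have "P.ge j (int (2 * m) * 1) (y ^ (2 * m))" using j y_arc Arc1 by (intro P.ge_power) auto
      from div[OF this] show ?thesis using Arc1 val_tpoly by (simp add: t_def)
    next
      case Arc2
      have "P.ge j (int (2 * m) * 1) (y ^ (2 * m))" using j y_arc Arc2 by (intro P.ge_power) auto
      from P.ge_mono[OF div[OF this], of 0] show ?thesis using Arc2 val_tpoly by (simp add: t_def)
    next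
      case (Prime f')
      have "P.ge j (int (2 * m) * 0) (y ^ (2 * m))" by (rule P.ge_power[OF j y_ge[OF j]])
      from div[OF this] show ?thesis using Prime val_Prime_tpoly j by (simp add: t_def)
    qed
  qed
  then have cA: "c \<in> P.ring_at places" by (auto simp: P.ring_at_def)
  have "to_fract q \<noteq> 0" using pq by simp
  then have "b * c = to_fract (p * p') * y ^ (2 * m) / t ^ m"
    by (simp add: pq(4) c_def Fract_conv_to_fract)
  also have "p * p' = tpoly ^ m - f * s" using ps by (simp add: algebra_simps)
  finally have "b * c = (t ^ m - to_fract f * to_fract s) * y ^ (2 * m) / t ^ m"
    by (simp add: t_def)
  then have bc: "b * c - 1 = (y ^ (2 * m) - 1) - (to_fract s * y ^ (2 * m)) * to_fract f / t ^ m"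
    using t0 by (simp add: field_simps)
  have "P.ge ?i 0 (to_fract s * y ^ (2 * m))"
    using P.ge_mult_left[OF i to_fract_ge[OF i] P.ge_power[OF i y_ge[OF i], of "2 * m"]] by simp
  note P.ge_divide[OF i P.ge_mult_left[OF i this \<open>P.ge ?i 1 (to_fract f)\<close>], of "t ^ m"]
  then have tail: "P.ge ?i 1 ((to_fract s * y ^ (2 * m)) * to_fract f / t ^ m)"
    using t0 i val_Prime_tpoly[OF i] by (simp add: P.v_power t_def)
  have "P.ge ?i 1 (b * c - 1)"
    unfolding bc by (rule P.ge_diff[OF i P.ge_power_minus_one[OF i y_ge[OF i] y_f] tail])
  then show ?thesis using cA by blast
qed

text \<open>For a zero at a prime \<open>j\<close>: its generator if \<open>i\<close> is a prime, an
  element from \<open>multiple_trivial_on_arcs\<close> if \<open>i\<close> is an arc. For a zero at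
  an arc \<open>j\<close>: \<open>t\<close> if \<open>i\<close> is a prime, otherwise
  \<open>x\<close> or \<open>x + 1\<close>.\<close>

lemma places_separated:
  assumes i: "i \<in> places" and j: "j \<in> places" and ne: "i \<noteq> j"
  shows "\<exists>a\<in>P.ring_at places. a \<noteq> 0 \<and> val i a = 0 \<and> 0 < val j a"
proof -
  have witness: ?thesis if "r \<noteq> 0" "nval i r = 0" "0 < nval j r" for r
    using that i j by (intro bexI[of _ "to_fract r"]) (auto simp: val_to_fract to_fract_in_A)
  show ?thesis
  proof (cases j)
    case (Prime f)
    note jf = this
    then have f: "prime f" using j by auto
    then have f0: "f \<noteq> 0" by auto
    have ff: "multiplicity f f = 1" using f f0 by (intro multiplicity_self) auto
    obtain g where "g \<in> P.ring_at places" "g \<noteq> 0" "val Arc1 g = 0" "val Arc2 g = 0"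
      "\<forall>i\<in>places - {Arc1, Arc2}. int (nval i f) \<le> val i g" using multiple_trivial_on_arcs[OF f0] by auto
    moreover from this have "int (nval j f) \<le> val j g" using j jf by blast
    then have "0 < val j g" using jf ff by simp
    ultimately have g: "\<exists>g\<in>P.ring_at places. g \<noteq> 0 \<and> val Arc1 g = 0 \<and> val Arc2 g = 0 \<and> 0 < val j g"
      by blast
    show ?thesis
    proof (cases i)
      case (Prime f')
      then have "multiplicity f' f = 0" using i f ne jf by (intro prime_multiplicity_other) auto
      then show ?thesis using witness[of f] f0 ff Prime jf by simp
    qed (use g in auto)
  next
    case Arc1
    show ?thesis
    proof (cases i)
      case Arc2
      show ?thesis by (rule witness[of "[:0, 1:]"]) (simp_all only: Arc1 Arc2 nval_linear, simp_all)
    next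
      case (Prime f)
      then have "nval i tpoly = 0" using i by (simp add: not_dvd_imp_multiplicity_0)
      then show ?thesis using witness[of tpoly] Arc1 nval_tpoly by (simp del: nval.simps)
    qed (use ne Arc1 in auto)
  next
    case Arc2
    show ?thesis
    proof (cases i)
      case Arc1
      show ?thesis by (rule witness[of "[:1, 1:]"]) (simp_all only: Arc1 Arc2 nval_linear, simp_all)
    next
      case (Prime f)
      then have "nval i tpoly = 0" using i by (simp add: not_dvd_imp_multiplicity_0)
      then show ?thesis using witness[of tpoly] Arc2 nval_tpoly by (simp del: nval.simps)
    qed (use ne Arc2 in auto)
  qed
qed

interpretation P: dedekind_family places val
proof
  fix i b assume "i \<in> places" "b \<in> P.ring_at places" "b \<noteq> 0" "val i b = 0"
  then show "\<exists>b'\<in>P.ring_at places. P.ge i 1 (b * b' - 1)"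
    by (cases i) (auto intro: residue_inverse_arc residue_inverse_Prime)
qed (rule places_separated)

section \<open>Product formula and principal divisors\<close>

interpretation arc1: nat_valuation "nval Arc1" by (rule arc_valuations)
interpretation arc2: nat_valuation "nval Arc2" by (rule arc_valuations)

lemma arc_weight_mult: "a \<noteq> 0 \<Longrightarrow> b \<noteq> 0 \<Longrightarrow> arc_weight (a * b) = arc_weight a + arc_weight b"
  by (simp add: arc_weight_def arc1.u_mult arc2.u_mult del: nval.simps)

lemma arc_weight_power: "a \<noteq> 0 \<Longrightarrow> arc_weight (a ^ n) = int n * arc_weight a"
  by (simp add: arc_weight_def arc1.u_power arc2.u_power algebra_simps del: nval.simps)

lemma arc_weight_unit: "is_unit a \<Longrightarrow> arc_weight a = 0"
  by (simp add: arc_weight_def arc1.u_unit arc2.u_unit del: nval.simps)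

lemma arc_weight_prod: "(\<And>i. i \<in> S \<Longrightarrow> f i \<noteq> 0) \<Longrightarrow> arc_weight (prod f S) = (\<Sum>i\<in>S. arc_weight (f i))"
  by (induction S rule: infinite_finite_induct) (auto simp: arc_weight_mult arc_weight_unit)

lemma arc_weight_normalize: "arc_weight (normalize a) = arc_weight a"
proof (cases "a = 0")
  case False
  then have "arc_weight (unit_factor a * normalize a) = arc_weight (normalize a)"
    by (subst arc_weight_mult) (auto simp: arc_weight_unit)
  then show ?thesis by simp
qed simp

lemma arc_weight_factorization:
  assumes "r \<noteq> 0"
  shows "arc_weight r = (\<Sum>f\<in>prime_factors r. int (multiplicity f r) * arc_weight f)"
proof -
  have "prod_mset (prime_factorization r) = (\<Prod>f\<in>prime_factors r. f ^ multiplicity f r)"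
    unfolding prod_mset_multiplicity
    by (rule prod.cong) (auto simp: count_prime_factorization_prime dest: in_prime_factors_imp_prime)
  then have "arc_weight r = arc_weight (\<Prod>f\<in>prime_factors r. f ^ multiplicity f r)"
    using prod_mset_prime_factorization_weak[OF assms] arc_weight_normalize by metis
  also have "\<dots> = (\<Sum>f\<in>prime_factors r. int (multiplicity f r) * arc_weight f)"
    by (subst arc_weight_prod) (auto intro!: sum.cong arc_weight_power dest: in_prime_factors_imp_prime)
  finally show ?thesis .
qed

text \<open>A nonzero constant of order \<open>k\<close> has values \<open>2 * k\<close> and
  \<open>k\<close> on the arcs.\<close>

lemma arc_weight_const: "arc_weight [:c:] = 0"
proof (cases "c = 0")
  case True
  then show ?thesis
    using comm_ring_hom_map.hom_zero[OF arc_eval_homs(1)] comm_ring_hom_map.hom_zero[OF arc_eval_homs(2)]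
    by (simp add: arc_weight_def)
next
  case False
  have "subdegree (coeff_embed e c) = e * subdegree c" if "e > 0" for e
  proof (rule subdegreeI)
    show "coeff_embed e c $ (e * subdegree c) \<noteq> 0"
      using that False by (simp add: coeff_embed_nth)
    show "coeff_embed e c $ n = 0" if n: "n < e * subdegree c" for n
    proof -
      have "n div e < subdegree c"
        by (rule less_mult_imp_div_less) (use n in \<open>simp only: mult.commute\<close>)
      then show ?thesis by (simp only: coeff_embed_nth nth_less_subdegree_zero to_ac_0 if_cancel)
    qed
  qed
  then show ?thesis by (simp add: arc_weight_def arc_eval_const)
qed

lemma arc_weight_dvd_tpoly: "f dvd tpoly \<Longrightarrow> arc_weight f = 0"
proof -
  assume "f dvd tpoly"
  then have "degree f = 0" using dvd_imp_degree_le[of f tpoly] by (simp add: tpoly_def)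
  then show ?thesis by (metis arc_weight_const degree_eq_zeroE)
qed

text \<open>The arcs contribute \<open>- arc_weight r\<close> and the primes
  \<open>arc_weight r\<close>. Allowing a set \<open>S\<close> larger than the set of prime factors
  lets the numerator and the denominator of a fraction share one set.\<close>

lemma divisor_degree_zero:
  assumes r: "r \<noteq> 0" and S: "finite S" "prime_factors r \<subseteq> S" "\<And>f. f \<in> S \<Longrightarrow> prime f"
  defines "Q \<equiv> {f \<in> S. \<not> f dvd tpoly \<and> arc_weight f \<noteq> 0}"
  shows "(\<Sum>i\<in>{Arc1, Arc2} \<union> Prime ` Q. weight i * int (nval i r)) = 0"
proof -
  have "arc_weight r = (\<Sum>f\<in>S. int (multiplicity f r) * arc_weight f)"
    unfolding arc_weight_factorization[OF r]
    by (rule sum.mono_neutral_left) (use S r in \<open>auto simp: prime_factors_multiplicity\<close>)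
  also have "\<dots> = (\<Sum>f\<in>Q. int (multiplicity f r) * arc_weight f)"
    by (rule sum.mono_neutral_right) (use S in \<open>auto simp: Q_def arc_weight_dvd_tpoly\<close>)
  finally have eq: "arc_weight r = (\<Sum>f\<in>Q. int (multiplicity f r) * arc_weight f)" .
  have "(\<Sum>i\<in>{Arc1, Arc2} \<union> Prime ` Q. weight i * int (nval i r)) =
      (\<Sum>i\<in>{Arc1, Arc2}. weight i * int (nval i r)) + (\<Sum>i\<in>Prime ` Q. weight i * int (nval i r))"
    by (rule sum.union_disjoint) (use S in \<open>auto simp: Q_def\<close>)
  also have "(\<Sum>i\<in>Prime ` Q. weight i * int (nval i r)) = (\<Sum>f\<in>Q. int (multiplicity f r) * arc_weight f)"
    by (subst sum.reindex) (auto simp: inj_on_def mult.commute)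
  also have "(\<Sum>i\<in>{Arc1, Arc2}. weight i * int (nval i r)) = - arc_weight r"
    by (simp add: arc_weight_def)
  finally show ?thesis using eq by simp
qed

lemma places_product_formula:
  assumes "x \<noteq> 0"
  shows "(\<Sum>i | i \<in> places \<and> val i x \<noteq> 0. weight i * val i x) = 0"
proof -
  obtain a b where ab: "a \<noteq> 0" "b \<noteq> 0" "x = Fract a b"
    using assms by (rule arc1.Fract_nonzeroE)
  define S where "S = prime_factors a \<union> prime_factors b"
  define R where "R = {Arc1, Arc2} \<union> Prime ` {f \<in> S. \<not> f dvd tpoly \<and> arc_weight f \<noteq> 0}"
  have S: "finite S" "\<And>f. f \<in> S \<Longrightarrow> prime f" by (auto simp: S_def)
  have R: "finite R" "R \<subseteq> places" using S by (auto simp: R_def)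
  have "(\<Sum>i | i \<in> places \<and> val i x \<noteq> 0. weight i * val i x) = (\<Sum>i\<in>R. weight i * val i x)"
  proof (rule sum.mono_neutral_left)
    show "{i \<in> places. val i x \<noteq> 0} \<subseteq> R"
      using nonzero_places[OF ab(1,2)] unfolding ab(3) R_def S_def by blast
  qed (use R in auto)
  also have "\<dots> = (\<Sum>i\<in>R. weight i * int (nval i a) - weight i * int (nval i b))"
    using R ab by (intro sum.cong) (auto simp: val_Fract right_diff_distrib simp del: nval.simps)
  also have "\<dots> = 0"
    unfolding sum_subtractf R_def
    using divisor_degree_zero[OF ab(1) S(1) _ S(2)] divisor_degree_zero[OF ab(2) S(1) _ S(2)]
    by (simp only: S_def Un_upper1 Un_upper2)
  finally show ?thesis .
qed

text \<open>The product \<open>x\<close> of prime powers has the prescribed values at the primes. By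
  the degree condition its defects at the arcs are \<open>2 * d\<close> and \<open>d\<close>, the
  values of \<open>tpoly\<close> to the power \<open>d\<close>.\<close>

lemma degree_zero_principal:
  assumes fin: "finite {i \<in> places. n i \<noteq> 0}"
    and sum: "(\<Sum>i | i \<in> places \<and> n i \<noteq> 0. weight i * n i) = 0"
  shows "\<exists>x. x \<noteq> 0 \<and> (\<forall>i\<in>places. val i x = n i)"
proof -
  define Q where "Q = {f. Prime f \<in> places \<and> n (Prime f) \<noteq> 0}"
  have "Prime ` Q \<subseteq> {i \<in> places. n i \<noteq> 0}" by (auto simp: Q_def)
  then have finQ: "finite Q" using fin by (metis finite_imageD finite_subset inj_onI place.inject)
  have Q_prime: "prime f" "f \<noteq> 0" if "f \<in> Q" for f using that by (auto simp: Q_def)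
  define x where "x = (\<Prod>f\<in>Q. to_fract f powi n (Prime f))"
  have x0: "x \<noteq> 0" using Q_prime finQ by (simp add: x_def)
  have vx: "val i x = (\<Sum>f\<in>Q. n (Prime f) * int (nval i f))" if "i \<in> places" for i
    unfolding x_def using that Q_prime
    by (subst P.v_prod) (auto intro!: sum.cong simp: P.v_power_int val_to_fract simp del: nval.simps)
  define d where "d = n Arc2 - val Arc2 x"
  have "0 = (\<Sum>i | i \<in> places \<and> n i \<noteq> 0. weight i * n i)" using sum by simp
  also have "\<dots> = (\<Sum>i\<in>{Arc1, Arc2} \<union> Prime ` Q. weight i * n i)"
  proof (rule sum.mono_neutral_left)
    show "{i \<in> places. n i \<noteq> 0} \<subseteq> {Arc1, Arc2} \<union> Prime ` Q"
    proof
      fix i assume "i \<in> {i \<in> places. n i \<noteq> 0}"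
      then show "i \<in> {Arc1, Arc2} \<union> Prime ` Q" by (cases i) (auto simp: Q_def)
    qed
  qed (use finQ in \<open>auto simp: Q_def\<close>)
  also have "\<dots> = (\<Sum>i\<in>{Arc1, Arc2}. weight i * n i) + (\<Sum>i\<in>Prime ` Q. weight i * n i)"
    by (rule sum.union_disjoint) (use finQ in auto)
  also have "(\<Sum>i\<in>Prime ` Q. weight i * n i) = (\<Sum>f\<in>Q. arc_weight f * n (Prime f))"
    by (subst sum.reindex) (auto simp: inj_on_def)
  also have "\<dots> = 2 * val Arc2 x - val Arc1 x"
    by (simp add: vx arc_weight_def sum_subtractf[symmetric] sum_distrib_left algebra_simps del: nval.simps)
  also have "(\<Sum>i\<in>{Arc1, Arc2}. weight i * n i) = n Arc1 - 2 * n Arc2" by simp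
  finally have n1: "n Arc1 = val Arc1 x + 2 * d" by (simp add: d_def algebra_simps del: nval.simps)
  have "val i (x * to_fract tpoly powi d) = n i" if i: "i \<in> places" for i
  proof -
    have eq: "val i (x * to_fract tpoly powi d) = val i x + d * val i (to_fract tpoly)"
      using x0 i by (simp add: P.v_mult P.v_power_int)
    show ?thesis
    proof (cases i)
      case (Prime f)
      have "val i x = (\<Sum>g\<in>Q. if g = f then n (Prime f) else 0)"
        unfolding vx[OF i]
      proof (rule sum.cong)
        fix g assume "g \<in> Q"
        then have "multiplicity f g = (if g = f then 1 else 0)"
          using Q_prime i Prime by (auto simp: multiplicity_self prime_multiplicity_other)
        then show "n (Prime g) * int (nval i g) = (if g = f then n (Prime f) else 0)"
          by (simp add: Prime)
      qed simp
      also have "\<dots> = n i" using i finQ Prime by (auto simp: Q_def)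
      finally show ?thesis unfolding eq using i Prime val_Prime_tpoly by simp
    qed (use n1 val_tpoly eq d_def in auto)
  qed
  then show ?thesis using x0 by (intro exI[of _ "x * to_fract tpoly powi d"]) auto
qed

section \<open>Weights that occur and the missing weight -1\<close>

lemma prime_normalize_linear:
  fixes a :: "bit fps"
  assumes "a \<noteq> fps_X"
  shows "prime (normalize [:a, 1:])" "\<not> normalize [:a, 1:] dvd tpoly"
proof -
  have dvd: "[:a, 1:] dvd p \<longleftrightarrow> poly p (- a) = 0" for p
    using poly_eq_0_iff_dvd[of p "- a"] by simp
  have "prime_elem [:a, 1:]"
    by (rule prime_elemI) (auto simp: dvd is_unit_poly_iff)
  then show "prime (normalize [:a, 1:])" by (simp add: prime_def)
  show "\<not> normalize [:a, 1:] dvd tpoly" by (simp add: dvd tpoly_def)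
qed

lemma arc_weight_linear: "arc_weight [:0, 1:] = -3" "arc_weight [:1, 1:] = 2"
  by (simp_all add: arc_weight_def nval_linear del: nval.simps)

lemma linear_places:
  "Prime (normalize [:0, 1:]) \<in> places" "weight (Prime (normalize [:0, 1:])) = -3"
  "Prime (normalize [:1, 1:]) \<in> places" "weight (Prime (normalize [:1, 1:])) = 2"
proof -
  have "(0 :: bit fps) \<noteq> fps_X" "(1 :: bit fps) \<noteq> fps_X"
    by (auto dest: arg_cong[of _ _ "\<lambda>f. f $ 1"])
  then show "Prime (normalize [:0, 1:]) \<in> places" "weight (Prime (normalize [:0, 1:])) = -3"
    "Prime (normalize [:1, 1:]) \<in> places" "weight (Prime (normalize [:1, 1:])) = 2"
    using prime_normalize_linear[of 0] prime_normalize_linear[of 1] arc_weight_linear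
    by (simp_all add: arc_weight_normalize)
qed

interpretation P: weighted_family places val weight
proof
  show "weight i \<noteq> 0" if "i \<in> places" for i using that by (cases i) auto
  show "\<exists>p\<in>places. \<exists>q\<in>places. p \<noteq> q \<and> 0 < weight p \<and> 0 < weight q"
    by (rule bexI[of _ Arc1], rule bexI[of _ "Prime (normalize [:1, 1:])"])
      (simp_all only: linear_places arcs_in_places, simp)
  show "\<exists>p\<in>places. \<exists>q\<in>places. p \<noteq> q \<and> weight p < 0 \<and> weight q < 0"
    by (rule bexI[of _ Arc2], rule bexI[of _ "Prime (normalize [:0, 1:])"])
      (simp_all only: linear_places arcs_in_places, simp)
qed (rule places_product_formula degree_zero_principal; assumption)+

lemma tpoly_dvd_if_residue_zero:
  fixes f :: "bit fps poly"
  assumes "map_poly (\<lambda>c. c $ 0) f = 0"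
  shows "tpoly dvd f"
proof
  have "coeff f i $ 0 = 0" for i
    using assms by (metis coeff_0 coeff_map_poly fps_zero_nth)
  then have "fps_X * fps_shift 1 (coeff f i) = coeff f i" for i
    by (intro fps_ext) (auto simp: Suc_diff_le split: nat.split)
  then show "f = tpoly * map_poly (fps_shift 1) f"
    by (intro poly_eqI) (simp add: tpoly_def coeff_map_poly)
qed

text \<open>No value of the first arc is 1 because its coordinates are \<open>s^2\<close> and \<open>s^3 \<gamma>(s)\<close>.\<close>

lemma arc1_eval_nth_1: "arc_eval 2 arc1 f $ 1 = 0"
proof (cases f)
  case (pCons c g)
  have "arc_eval 2 arc1 f = coeff_embed 2 c + arc1 * arc_eval 2 arc1 g"
    using comm_ring_hom_map.hom_zero[OF coeff_embed_hom, of 2]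
    by (simp add: arc_eval_def pCons map_poly_pCons)
  then show ?thesis by (simp add: coeff_embed_nth arc1_def mult.assoc fps_X_power_mult_nth)
qed

lemma arc_weight_prime_neq:
  assumes f: "prime f" "\<not> f dvd tpoly"
  shows "arc_weight f \<noteq> -1"
proof
  assume "arc_weight f = -1"
  then have eq: "nval Arc1 f = 2 * nval Arc2 f + 1" by (simp add: arc_weight_def del: nval.simps)
  have f0: "f \<noteq> 0" using f by auto
  have "nval Arc1 f \<noteq> 1"
  proof
    assume "nval Arc1 f = 1"
    then have "arc_eval 2 arc1 f $ 1 \<noteq> 0"
      using nth_subdegree_nonzero[OF arc_eval_nonzero(1)[OF f0]] by simp
    then show False using arc1_eval_nth_1 by simp
  qed
  \<comment> \<open>The equation allows \<open>nval Arc2 f = 0\<close> only together with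
    \<open>nval Arc1 f = 1\<close>.\<close>
  then have pos: "0 < nval Arc1 f" "0 < nval Arc2 f" using eq by auto
  let ?f = "map_poly (\<lambda>c. c $ 0) f"
  have embed: "poly (map_poly to_ac ?f) (to_ac a) = to_ac (poly ?f a)" for a
    by (rule comm_ring_hom_map.poly_fixed_coeffs[OF to_ac_hom, symmetric]) (simp add: coeff_map_poly)
  \<comment> \<open>Positive values on the arcs mean that the reduction of \<open>f\<close> modulo
    \<open>t\<close> vanishes at their starting points 0 and 1.\<close>
  have "arc_eval 2 arc1 f $ 0 = 0" "arc_eval 1 arc2 f $ 0 = 0"
    using pos by (auto intro: nth_less_subdegree_zero)
  then have "poly (map_poly to_ac ?f) (to_ac 0) = 0" "poly (map_poly to_ac ?f) (to_ac 1) = 0"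
    by (simp_all add: arc_eval_nth_0 arc1_def arc2_def)
  then have roots: "poly ?f 0 = 0" "poly ?f 1 = 0" unfolding embed by simp_all
  \<comment> \<open>Otherwise \<open>tpoly\<close> divides \<open>f\<close>; since \<open>f\<close>
    is prime and does not divide \<open>tpoly\<close>, this would make \<open>tpoly\<close> a
    unit.\<close>
  have "?f \<noteq> 0"
  proof
    assume "?f = 0"
    then obtain g where g: "f = tpoly * g" using tpoly_dvd_if_residue_zero by blast
    then have "f dvd tpoly \<or> f dvd g" using f(1) prime_dvd_multD[of f tpoly g] by simp
    then have "f dvd g" using f by simp
    then obtain h where "g = f * h" by blast
    then have "f * 1 = f * (tpoly * h)" using g by (simp add: algebra_simps)
    then have "tpoly * h = 1" using f0 by (metis mult_left_cancel)
    then have "is_unit tpoly" by (metis dvdI)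
    then show False by (simp add: tpoly_def is_unit_poly_iff)
  qed
  moreover have "coeff f 0 $ 0 = 0" using roots by (simp add: poly_0_coeff_0 coeff_map_poly)
  ultimately have "\<not> irreducible f" using reducible_if_two_residue_roots roots(2) by blast
  then show False using f by (simp add: prime_elem_imp_irreducible)
qed

lemma no_weight_minus_one: "i \<in> places \<Longrightarrow> weight i \<noteq> -1"
  using arc_weight_prime_neq by (cases i) auto

section \<open>The two overrings and the embedding into the reals\<close>

lemma well_centered_example: "well_centered_set (P.ring_at places) (P.ring_at P.neg)"
  by (rule P.well_centered_ring_at_neg[of Arc1]) simp_all

lemma not_well_centered_example: "\<not> well_centered_set (P.ring_at places) (P.ring_at P.pos)"
  by (rule P.not_well_centered_ring_at_pos[OF _ _ _ _ linear_places(1,2) no_weight_minus_one, of Arc1 Arc2]) simp_all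

text \<open>Coefficients are bits, so a polynomial over power series is coded by a set of pairs of
  naturals, and a fraction by its normalized numerator and denominator; sets of naturals inject into
  the reals.\<close>

lemma inj_fract_real: "\<exists>h :: bit fps poly fract \<Rightarrow> real. inj h"
proof -
  define code :: "bit fps poly \<Rightarrow> (nat \<times> nat) set" where
    "code p = {(i, k). coeff p i $ k = 1}" for p
  have bit: "b = c" if "b = 1 \<longleftrightarrow> c = 1" for b c :: bit
    using that by (metis bit_not_one_iff)
  have "inj code"
  proof (rule injI)
    fix p q assume "code p = code q"
    then have "coeff p i $ k = 1 \<longleftrightarrow> coeff q i $ k = 1" for i k
      by (auto simp: code_def set_eq_iff)
    then show "p = q" by (intro poly_eqI fps_ext bit)
  qed
  define code2 :: "bit fps poly fract \<Rightarrow> (bool \<times> nat \<times> nat) set" where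
    "code2 x = {True} \<times> code (fst (quot_of_fract x)) \<union> {False} \<times> code (snd (quot_of_fract x))" for x
  have "inj code2"
  proof (rule injI)
    fix x y assume eq: "code2 x = code2 y"
    have "code (fst (quot_of_fract x)) = {a. (True, a) \<in> code2 x}"
      "code (snd (quot_of_fract x)) = {a. (False, a) \<in> code2 x}" for x
      by (auto simp: code2_def)
    then have "quot_of_fract x = quot_of_fract y"
      using eq \<open>inj code\<close> by (intro prod_eqI) (metis injD)+
    then show "x = y" by (metis Fract_quot_of_fract)
  qed
  moreover have "inj (image (to_nat :: bool \<times> nat \<times> nat \<Rightarrow> nat))"
    by (simp add: inj_image_eq_iff inj_on_def)
  moreover obtain g :: "nat set \<Rightarrow> real" where "inj g"
    using nat_sets_lepoll_reals01 by (auto simp: lepoll_def)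
  ultimately have "inj (g \<circ> image to_nat \<circ> code2)" by (intro inj_compose)
  then show ?thesis by blast
qed

theorem theorem3p16:
  shows "(\<exists>(K :: real ring) A. dedekind_domain_in K A \<and>
            (\<exists>D. overring K A D \<and> well_centered K A D \<and> \<not> is_localization K A D) \<and>
            exactly_two_special K A)
       \<and> (\<exists>(K :: real ring) A. dedekind_domain_in K A \<and>
            (\<exists>D. overring K A D \<and> almost_well_centered K A D \<and> \<not> well_centered K A D) \<and>
            exactly_two_special K A)"
proof -
  obtain h :: "bit fps poly fract \<Rightarrow> real" where h: "inj h"
    using inj_fract_real by blast
  \<comment> \<open>One ring serves both parts: \<open>P.neg\<close> gives the well-centered
    overring, \<open>P.pos\<close> the one that is only almost well-centered.\<close>
  let ?K = "field_ring h" and ?A = "h ` P.ring_at places"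
  have sub: "subring_set (P.ring_at P.neg)" "subring_set (P.ring_at P.pos)"
    "P.ring_at places \<subseteq> P.ring_at P.neg" "P.ring_at places \<subseteq> P.ring_at P.pos"
    using P.ring_at_subring P.ring_at_antimono P.pos_neg(3,4) by auto
  have base: "dedekind_domain_in ?K ?A" "exactly_two_special ?K ?A"
    by (rule P.dedekind_domain_image[OF h] P.exactly_two_special_image[OF h])+
  have "overring ?K ?A (h ` P.ring_at P.neg)" "overring ?K ?A (h ` P.ring_at P.pos)"
    unfolding overring_image[OF h] using sub by blast+
  moreover have "well_centered ?K ?A (h ` P.ring_at P.neg)"
    "\<not> is_localization ?K ?A (h ` P.ring_at P.neg)"
    using well_centered_example P.not_localization_ring_at_neg
    by (simp_all add: well_centered_image[OF h] localization_image[OF h])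
  moreover have "almost_well_centered ?K ?A (h ` P.ring_at P.pos)"
    "\<not> well_centered ?K ?A (h ` P.ring_at P.pos)"
    using P.ring_at_pos_facts(1) not_well_centered_example
    by (simp_all add: well_centered_image[OF h] almost_well_centered_image[OF h])
  ultimately show ?thesis using base by blast
qed

end
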